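(* Let $S$ be a smooth phase function on a neighborhood of the origin in $\mathbb{R}^2$ in superadapted coordinates with Newton distance $d=d(S)>1$. If $\phi\in C_c^\infty(\mathbb{R}^2)$ is real-valued and supported in a sufficiently small neighborhood of the origin, then there is a positive constant $B_{S,\phi}$ such that for all sufficiently small $\epsilon>0$: in Cases 1 and 3, $$I_{S,\phi}(\epsilon)<B_{S,\phi}\,\epsilon^{1/d};$$ in Case 2, $$I_{S,\phi}(\epsilon)<B_{S,\phi}\,|\ln(\epsilon)|\,\epsilon^{1/d}.$$
   Context: Standing assumptions: $S$ is real-valued, $S(0,0)=0$, $\nabla S(0,0)=0$, and the Taylor expansion $\sum_{a,b}s_{ab}x^ay^b$ of $S$ at the origin is not identically zero. Newton polygon: $N(S)$ is the convex hull of the union of the quadrants $\{(t_1,t_2): t_1\ge a,\ t_2\ge b\}$ over all $(a,b)$ with $s_{ab}\neq0$. Its boundary consists of finitely many (possibly zero) compact edges of negative slope together with an unbounded vertical ray and an unbounded horizontal ray. The Newton distance is $d(S)=\inf\{t:(t,t)\in N(S)\}$, and the bisectrix is the line $t_1=t_2$. "The bisectrix intersects $N(S)$" at/in a part of $N(S)$ means that the boundary point $(d(S),d(S))$ lies there. For a compact edge $e$ of $N(S)$ put $S_e(x,y)=\sum_{(a,b)\in e}s_{ab}x^ay^b$. $S$ is in superadapted coordinates if for every compact edge $e$ of $N(S)$ intersecting the bisectrix, neither $S_e(1,y)$ nor $S_e(-1,y)$ has a real zero of order $\ge d(S)$ other than possibly $y=0$. Case 1: the bisectrix intersects $N(S)$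 in the interior of a compact edge. Case 2: it intersects $N(S)$ at a vertex $(d,d)$. Case 3: it intersects $N(S)$ in the interior of one of the unbounded rays. $I_{S,\phi}(\epsilon)=\int_{\{(x,y):0<S(x,y)<\epsilon\}}\phi(x,y)\,dx\,dy$. *)

theory Defs
  imports "HOL-Analysis.Analysis" "HOL-Computational_Algebra.Polynomial"
begin

definition partial_x :: "(real \<times> real \<Rightarrow> real) \<Rightarrow> real \<times> real \<Rightarrow> real" where
  "partial_x f = (\<lambda>(x, y). deriv (\<lambda>t. f (t, y)) x)"

definition partial_y :: "(real \<times> real \<Rightarrow> real) \<Rightarrow> real \<times> real \<Rightarrow> real" where
  "partial_y f = (\<lambda>(x, y). deriv (\<lambda>t. f (x, t)) y)"

text \<open>
  \<open>Ck_on k f U\<close>, intended for open \<open>U\<close>: all iterated partial derivatives of \<open>f\<close> of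
  total order at most \<open>k\<close>, in any order of differentiation, exist and are continuous on \<open>U\<close>.
  Existence has to be required separately because \<open>deriv\<close> is total.
\<close>

primrec Ck_on :: "nat \<Rightarrow> (real \<times> real \<Rightarrow> real) \<Rightarrow> (real \<times> real) set \<Rightarrow> bool" where
  "Ck_on 0 f U \<longleftrightarrow> continuous_on U f"
| "Ck_on (Suc k) f U \<longleftrightarrow>
     continuous_on U f \<and>
     (\<forall>(x, y)\<in>U. (\<lambda>t. f (t, y)) field_differentiable at x \<and>
                 (\<lambda>t. f (x, t)) field_differentiable at y) \<and>
     Ck_on k (partial_x f) U \<and> Ck_on k (partial_y f) U"

definition smooth_on :: "(real \<times> real \<Rightarrow> real) \<Rightarrow> (real \<times> real) set \<Rightarrow> bool" where
  "smooth_on f U \<longleftrightarrow> (\<forall>k. Ck_on k f U)"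

definition supp :: "(real \<times> real \<Rightarrow> real) \<Rightarrow> (real \<times> real) set" where
  "supp f = closure {p. f p \<noteq> 0}"

definition taylor_coeff :: "(real \<times> real \<Rightarrow> real) \<Rightarrow> nat \<Rightarrow> nat \<Rightarrow> real" where
  "taylor_coeff S a b = (partial_x ^^ a) ((partial_y ^^ b) S) (0, 0) / (fact a * fact b)"

definition newton_polygon :: "(real \<times> real \<Rightarrow> real) \<Rightarrow> (real \<times> real) set" where
  "newton_polygon S =
     convex hull (\<Union>(a, b)\<in>{(a, b). taylor_coeff S a b \<noteq> 0}.
       {(t1, t2). t1 \<ge> real a \<and> t2 \<ge> real b})"

definition newton_distance :: "(real \<times> real \<Rightarrow> real) \<Rightarrow> real" where
  "newton_distance S = Inf {t. (t, t) \<in> newton_polygon S}"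

text \<open>The boundary point at which the bisectrix meets the Newton polygon.\<close>

definition bisectrix_point :: "(real \<times> real \<Rightarrow> real) \<Rightarrow> real \<times> real" where
  "bisectrix_point S = (newton_distance S, newton_distance S)"

definition compact_edge :: "(real \<times> real) set \<Rightarrow> (real \<times> real \<Rightarrow> real) \<Rightarrow> bool" where
  "compact_edge e S \<longleftrightarrow> e edge_of newton_polygon S \<and> compact e"

definition unbounded_ray :: "(real \<times> real) set \<Rightarrow> (real \<times> real \<Rightarrow> real) \<Rightarrow> bool" where
  "unbounded_ray e S \<longleftrightarrow> e edge_of newton_polygon S \<and> \<not> bounded e"

text \<open>
  For fixed \<open>x\<close>, \<open>edge_poly S e x\<close> is the univariate polynomial \<open>y \<mapsto> S\<^sub>e(x,y)\<close>, where
  \<open>S\<^sub>e(x,y)\<close> is the sum of \<open>s\<^sub>a\<^sub>b x\<^sup>a y\<^sup>b\<close> over the lattice points \<open>(a,b)\<close> of \<open>e\<close>; the index set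
  is finite for a compact edge.
\<close>

definition edge_poly ::
    "(real \<times> real \<Rightarrow> real) \<Rightarrow> (real \<times> real) set \<Rightarrow> real \<Rightarrow> real poly" where
  "edge_poly S e x =
     (\<Sum>(a, b)\<in>{(a, b). (real a, real b) \<in> e}. monom (taylor_coeff S a b * x ^ a) b)"

definition superadapted :: "(real \<times> real \<Rightarrow> real) \<Rightarrow> bool" where
  "superadapted S \<longleftrightarrow>
     (\<forall>e. compact_edge e S \<and> bisectrix_point S \<in> e \<longrightarrow>
        (\<forall>c\<in>{1, -1}. \<forall>r. r \<noteq> 0 \<and> poly (edge_poly S e c) r = 0 \<longrightarrow>
           \<not> real (order r (edge_poly S e c)) \<ge> newton_distance S))"

definition case1 :: "(real \<times> real \<Rightarrow> real) \<Rightarrow> bool" where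
  "case1 S \<longleftrightarrow> (\<exists>e. compact_edge e S \<and> bisectrix_point S \<in> rel_interior e)"

definition case2 :: "(real \<times> real \<Rightarrow> real) \<Rightarrow> bool" where
  "case2 S \<longleftrightarrow> bisectrix_point S extreme_point_of newton_polygon S"

definition case3 :: "(real \<times> real \<Rightarrow> real) \<Rightarrow> bool" where
  "case3 S \<longleftrightarrow> (\<exists>e. unbounded_ray e S \<and> bisectrix_point S \<in> rel_interior e)"

text \<open>
  The phase is only meaningful on its neighborhood \<open>U\<close> of the origin, so the domain of
  integration is cut to \<open>U\<close>; this is harmless when \<open>supp \<phi> \<subseteq> U\<close>.
\<close>

definition sublevel_integral ::
    "(real \<times> real) set \<Rightarrow> (real \<times> real \<Rightarrow> real) \<Rightarrow> (real \<times> real \<Rightarrow> real) \<Rightarrow> real \<Rightarrow> real" where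
  "sublevel_integral U S \<phi> \<epsilon> = (LINT p:{p\<in>U. 0 < S p \<and> S p < \<epsilon>}|lborel. \<phi> p)"

end

theory Submission
  imports Defs
begin

text \<open>
  Choose weights \<open>p, q > 0\<close> and a line \<open>p t\<^sub>1 + q t\<^sub>2 = w\<close> supporting the Newton polygon.
  Under the dilations \<open>(x, y) \<mapsto> (exp (-p j) x, exp (-q j) y)\<close> the phase, multiplied by \<open>exp (w j)\<close>,
  converges with all its derivatives to the polynomial \<open>P\<close> formed by the Taylor monomials on the line.
  If at every point of a compact annulus some pure derivative of \<open>P\<close> of order at most \<open>K\<close> is nonzero,
  van der Corput bounds the part of the sublevel set in the \<open>j\<close>-th dilated annulus by a constant times
  \<open>exp (-(p + q) j) (\<epsilon> exp (w j))\<^bsup>1/K\<^esup>\<close>. Summing over \<open>j\<close> up to the scale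
  \<open>exp (-w j) = \<epsilon>\<close> gives a geometric sum with ratio \<open>exp (w/K - (p + q))\<close>.

  In Case 1 the line is the one through the edge, so \<open>w = d (p + q)\<close>, and superadaptedness gives
  \<open>K < d\<close>: the sum is dominated by its last term. In Case 2 one has \<open>w = d (p + q)\<close> and \<open>K = d\<close>, so all
  terms are equal, whence the logarithm. In Case 3 one takes a line touching the polygon only at the vertex of the
  ray; then \<open>K = d\<close> and \<open>w < d (p + q)\<close>, and the sum converges.
\<close>

subsection \<open>Partial derivatives and Taylor expansion\<close>

text \<open>The phase is only smooth, so its Taylor series need not represent it. The substitute is
  uniform convergence of the rescaled derivatives for |u|, |v| <= 2, taken from a finite Taylor
  polynomial whose remainder terms x^N and y^N lie strictly above the supporting line.

  Nonvanishing derivatives of P are needed at every point of the annulus. Off the axes P is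
  quasi-homogeneous, so a point can be moved to u = 1 or u = -1, where P becomes the edge polynomial
  and the order of its zero bounds the order of the derivative. Superadaptedness is silent about the
  axes. There one needs monomials on the line: one with b <= K for v = 0, differentiating b times in
  y, and one with a <= K for u = 0, differentiating a times in x. This is why exponents on both
  sides of the bisectrix must be controlled and why x-derivatives enter at all.

  The dilations require p, q > 0, whereas the supporting line at (d, d) may be horizontal or
  vertical in Cases 2 and 3. It is then tilted about a vertex so that all other monomials stay
  strictly above it.\<close>

lemma smooth_on_partial_x: "smooth_on f U \<Longrightarrow> smooth_on (partial_x f) U"
  unfolding smooth_on_def using Ck_on.simps(2) by blast

lemma smooth_on_partial_y: "smooth_on f U \<Longrightarrow> smooth_on (partial_y f) U"
  unfolding smooth_on_def using Ck_on.simps(2) by blast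

lemma smooth_on_higher_partial_x: "smooth_on f U \<Longrightarrow> smooth_on ((partial_x ^^ a) f) U"
  by (induction a) (auto intro: smooth_on_partial_x)

lemma smooth_on_higher_partial_y: "smooth_on f U \<Longrightarrow> smooth_on ((partial_y ^^ a) f) U"
  by (induction a) (auto intro: smooth_on_partial_y)

lemma smooth_on_imp_continuous_on: "smooth_on f U \<Longrightarrow> continuous_on U f"
  unfolding smooth_on_def by (metis Ck_on.simps(1))

lemma smooth_on_DERIV_x:
  assumes "smooth_on f U" "(x, y) \<in> U"
  shows "((\<lambda>t. f (t, y)) has_real_derivative partial_x f (x, y)) (at x)"
proof -
  have "Ck_on (Suc 0) f U" using assms(1) unfolding smooth_on_def by blast
  then have "(\<lambda>t. f (t, y)) field_differentiable at x" using assms(2) by fastforce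
  then show ?thesis by (simp add: partial_x_def DERIV_deriv_iff_field_differentiable)
qed

lemma smooth_on_DERIV_y:
  assumes "smooth_on f U" "(x, y) \<in> U"
  shows "((\<lambda>t. f (x, t)) has_real_derivative partial_y f (x, y)) (at y)"
proof -
  have "Ck_on (Suc 0) f U" using assms(1) unfolding smooth_on_def by blast
  then have "(\<lambda>t. f (x, t)) field_differentiable at y" using assms(2) by fastforce
  then show ?thesis by (simp add: partial_y_def DERIV_deriv_iff_field_differentiable)
qed

section \<open>Locality and symmetry of mixed partial derivatives\<close>

lemma open_box_around:
  fixes U :: "(real \<times> real) set"
  assumes "open U" "(x, y) \<in> U"
  obtains r where "r > 0" "{x - r..x + r} \<times> {y - r..y + r} \<subseteq> U"
proof -
  obtain e where e: "e > 0" "ball (x, y) e \<subseteq> U"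
    using assms open_contains_ball by blast
  have "(a, b) \<in> U" if "a \<in> {x - e / 3..x + e / 3}" "b \<in> {y - e / 3..y + e / 3}" for a b
  proof -
    have "dist (x, y) (a, b) \<le> \<bar>x - a\<bar> + \<bar>y - b\<bar>"
      unfolding dist_prod_def using sqrt_sum_squares_le_sum_abs[of "x - a" "y - b"]
      by (simp add: dist_real_def)
    moreover have "\<bar>x - a\<bar> \<le> e / 3" "\<bar>y - b\<bar> \<le> e / 3"
      using that unfolding abs_le_iff by (simp_all only: atLeastAtMost_iff) linarith+
    ultimately have "dist (x, y) (a, b) < e" using e(1) by linarith
    then show ?thesis using e(2) by auto
  qed
  then have "{x - e / 3..x + e / 3} \<times> {y - e / 3..y + e / 3} \<subseteq> U"
    by auto
  then show ?thesis using e(1) that[of "e / 3"] by auto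
qed

lemma open_eventually_x:
  fixes U :: "(real \<times> real) set"
  assumes "open U" "(x, y) \<in> U" shows "eventually (\<lambda>t. (t, y) \<in> U) (nhds x)"
  by (rule eventually_compose_filterlim[of "\<lambda>p. p \<in> U" "nhds (x, y)"])
     (auto intro!: assms eventually_nhds_in_open tendsto_Pair filterlim_ident)

lemma open_eventually_y:
  fixes U :: "(real \<times> real) set"
  assumes "open U" "(x, y) \<in> U" shows "eventually (\<lambda>t. (x, t) \<in> U) (nhds y)"
  by (rule eventually_compose_filterlim[of "\<lambda>p. p \<in> U" "nhds (x, y)"])
     (auto intro!: assms eventually_nhds_in_open tendsto_Pair filterlim_ident)

lemma partial_x_cong:
  assumes "open U" "\<And>p. p \<in> U \<Longrightarrow> f p = g p" "p \<in> U"
  shows "partial_x f p = partial_x g p"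
proof (cases p)
  case (Pair x y)
  have "eventually (\<lambda>t. f (t, y) = g (t, y)) (nhds x)"
    using open_eventually_x[of U x y] assms Pair by (auto elim: eventually_mono)
  then show ?thesis unfolding partial_x_def Pair by (auto intro: deriv_cong_ev)
qed

lemma partial_y_cong:
  assumes "open U" "\<And>p. p \<in> U \<Longrightarrow> f p = g p" "p \<in> U"
  shows "partial_y f p = partial_y g p"
proof (cases p)
  case (Pair x y)
  have "eventually (\<lambda>t. f (x, t) = g (x, t)) (nhds y)"
    using open_eventually_y[of U x y] assms Pair by (auto elim: eventually_mono)
  then show ?thesis unfolding partial_y_def Pair by (auto intro: deriv_cong_ev)
qed

text \<open>The second difference over a square is symmetric in the two coordinates, so it can be
  compared with both mixed partials. The mean value theorem is applied in x to the increment in y,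
  then in y.\<close>

lemma mixed_difference_MVT:
  assumes f: "smooth_on f U" and h: "h > 0"
    and box: "{x..x + h} \<times> {y..y + h} \<subseteq> U"
  shows "\<exists>\<xi>\<in>{x..x + h}. \<exists>\<eta>\<in>{y..y + h}.
    f (x + h, y + h) - f (x + h, y) - f (x, y + h) + f (x, y) = h * h * partial_y (partial_x f) (\<xi>, \<eta>)"
proof -
  let ?g = "\<lambda>t. f (t, y + h) - f (t, y)"
  have "\<exists>z>x. z < x + h \<and> ?g (x + h) - ?g x =
      (x + h - x) * (partial_x f (z, y + h) - partial_x f (z, y))"
    using h box by (intro MVT2) (auto intro!: DERIV_diff smooth_on_DERIV_x[OF f])
  then obtain \<xi> where \<xi>: "x < \<xi>" "\<xi> < x + h"
    "?g (x + h) - ?g x = h * (partial_x f (\<xi>, y + h) - partial_x f (\<xi>, y))" by auto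
  have "\<exists>z>y. z < y + h \<and> partial_x f (\<xi>, y + h) - partial_x f (\<xi>, y) =
      (y + h - y) * partial_y (partial_x f) (\<xi>, z)"
    using h box \<xi> by (intro MVT2) (auto intro!: smooth_on_DERIV_y[OF smooth_on_partial_x[OF f]])
  then obtain \<eta> where \<eta>: "y < \<eta>" "\<eta> < y + h"
    "partial_x f (\<xi>, y + h) - partial_x f (\<xi>, y) = h * partial_y (partial_x f) (\<xi>, \<eta>)" by auto
  show ?thesis using \<xi> \<eta> by (intro bexI[of _ \<xi>] bexI[of _ \<eta>]) auto
qed

text \<open>Conjugation by \<open>prod.swap\<close> exchanges the roles of the variables. It serves
  the symmetry of the second difference here and the passage from y- to x-derivatives in the local
  bounds.\<close>

lemma partial_x_swap: "partial_x (f \<circ> prod.swap) = partial_y f \<circ> prod.swap"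
  by (auto simp: partial_x_def partial_y_def fun_eq_iff)

lemma partial_y_swap: "partial_y (f \<circ> prod.swap) = partial_x f \<circ> prod.swap"
  by (auto simp: partial_x_def partial_y_def fun_eq_iff)

lemma Ck_on_swap: "Ck_on k f U \<Longrightarrow> Ck_on k (f \<circ> prod.swap) (prod.swap ` U)"
proof (induction k arbitrary: f)
  case 0
  then show ?case
    by (simp del: o_apply) (intro continuous_on_compose continuous_on_swap, simp add: image_image)
next
  case (Suc k)
  have "continuous_on (prod.swap ` U) (f \<circ> prod.swap)"
    using Suc.prems by (intro continuous_on_compose continuous_on_swap) (simp add: image_image)
  moreover have "\<forall>(x, y)\<in>prod.swap ` U. (\<lambda>t. (f \<circ> prod.swap) (t, y)) field_differentiable at x \<and>
                 (\<lambda>t. (f \<circ> prod.swap) (x, t)) field_differentiable at y"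
    using Suc.prems by fastforce
  ultimately show ?case using Suc
    by (simp add: partial_x_swap partial_y_swap del: o_apply)
qed

lemma smooth_on_swap: "smooth_on f U \<Longrightarrow> smooth_on (f \<circ> prod.swap) (prod.swap ` U)"
  unfolding smooth_on_def using Ck_on_swap by blast

lemma higher_partial_x_swap: "(partial_x ^^ a) (f \<circ> prod.swap) = (partial_y ^^ a) f \<circ> prod.swap"
  by (induction a) (simp_all only: funpow.simps id_apply comp_apply[where f = partial_x] comp_apply[where f = partial_y] partial_x_swap)

lemma higher_partial_y_swap: "(partial_y ^^ a) (f \<circ> prod.swap) = (partial_x ^^ a) f \<circ> prod.swap"
  by (induction a) (simp_all only: funpow.simps id_apply comp_apply[where f = partial_x] comp_apply[where f = partial_y] partial_y_swap)

text \<open>Both mixed partials arise from the same second difference over squares of side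
  \<open>h n\<close> shrinking to the point; continuity of the second derivatives takes care of the
  intermediate points.\<close>

lemma mixed_partials_commute:
  assumes f: "smooth_on f U" and U: "open U" "(x, y) \<in> U"
  shows "partial_y (partial_x f) (x, y) = partial_x (partial_y f) (x, y)"
proof -
  obtain r where r: "r > 0" "{x - r..x + r} \<times> {y - r..y + r} \<subseteq> U"
    using open_box_around[OF U] .
  define h where "h n = r / real (Suc n)" for n
  have h: "h n > 0" "h n \<le> r" for n
    using r(1) by (auto simp: h_def divide_simps mult_le_cancel_left1)
  have h0: "h \<longlonglongrightarrow> 0"
    unfolding h_def by (rule LIMSEQ_Suc[OF lim_const_over_n])
  have box: "{x..x + h n} \<times> {y..y + h n} \<subseteq> U" for n
    using r h[of n] by force
  have box': "{y..y + h n} \<times> {x..x + h n} \<subseteq> prod.swap ` U" for n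
    using box[of n] by force
  have *: "\<exists>\<xi>\<in>{x..x + h n}. \<exists>\<eta>\<in>{y..y + h n}. \<exists>\<xi>'\<in>{x..x + h n}. \<exists>\<eta>'\<in>{y..y + h n}.
     partial_y (partial_x f) (\<xi>, \<eta>) = partial_x (partial_y f) (\<xi>', \<eta>')" for n
  proof -
    obtain \<xi> \<eta> where 1: "\<xi> \<in> {x..x + h n}" "\<eta> \<in> {y..y + h n}"
      "f (x + h n, y + h n) - f (x + h n, y) - f (x, y + h n) + f (x, y)
        = h n * h n * partial_y (partial_x f) (\<xi>, \<eta>)"
      using mixed_difference_MVT[OF f h(1) box] by metis
    \<comment> \<open>The same lemma for the swapped function: the two off-diagonal corner values
      change places, and the second difference stays the same.\<close>
    obtain \<eta>' \<xi>' where 2: "\<eta>' \<in> {y..y + h n}" "\<xi>' \<in> {x..x + h n}"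
      "f (x + h n, y + h n) - f (x, y + h n) - f (x + h n, y) + f (x, y)
        = h n * h n * partial_x (partial_y f) (\<xi>', \<eta>')"
      using mixed_difference_MVT[OF smooth_on_swap[OF f] h(1)[of n] box'[of n]]
      by (auto simp: partial_x_swap partial_y_swap)
    have "h n * h n * partial_y (partial_x f) (\<xi>, \<eta>) = h n * h n * partial_x (partial_y f) (\<xi>', \<eta>')"
      using 1(3) 2(3) by linarith
    then have "partial_y (partial_x f) (\<xi>, \<eta>) = partial_x (partial_y f) (\<xi>', \<eta>')"
      using h(1)[of n] by simp
    then show ?thesis 
      by - (rule bexI[OF _ 1(1)], rule bexI[OF _ 1(2)], rule bexI[OF _ 2(2)], rule bexI[OF _ 2(1)])
  qed
  then obtain \<xi> \<eta> \<xi>' \<eta>' where **: "\<And>n. \<xi> n \<in> {x..x + h n}" "\<And>n. \<eta> n \<in> {y..y + h n}"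
    "\<And>n. \<xi>' n \<in> {x..x + h n}" "\<And>n. \<eta>' n \<in> {y..y + h n}"
    "\<And>n. partial_y (partial_x f) (\<xi> n, \<eta> n) = partial_x (partial_y f) (\<xi>' n, \<eta>' n)"
    by metis
  have squeeze: "s \<longlonglongrightarrow> a" if "\<And>n. s n \<in> {a..a + h n}" for s a
  proof (rule tendsto_sandwich[of "\<lambda>_. a" _ _ "\<lambda>n. a + h n"])
    show "(\<lambda>n. a + h n) \<longlonglongrightarrow> a" using tendsto_add[OF tendsto_const[of a] h0] by simp
  qed (use that in auto)
  have cont: "continuous (at (x, y)) g" if "smooth_on g U" for g
    using smooth_on_imp_continuous_on[OF that] U by (simp add: continuous_on_eq_continuous_at)
  have "(\<lambda>n. partial_y (partial_x f) (\<xi> n, \<eta> n)) \<longlonglongrightarrow> partial_y (partial_x f) (x, y)"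
    by (intro isCont_tendsto_compose[OF cont] tendsto_Pair squeeze **
          smooth_on_partial_x smooth_on_partial_y f)
  moreover have "(\<lambda>n. partial_x (partial_y f) (\<xi>' n, \<eta>' n)) \<longlonglongrightarrow> partial_x (partial_y f) (x, y)"
    by (intro isCont_tendsto_compose[OF cont] tendsto_Pair squeeze **
          smooth_on_partial_x smooth_on_partial_y f)
  ultimately show ?thesis unfolding **(5) by (rule LIMSEQ_unique)
qed

lemma partial_y_higher_partial_x:
  assumes "smooth_on f U" "open U"
  shows "p \<in> U \<Longrightarrow> partial_y ((partial_x ^^ b) f) p = (partial_x ^^ b) (partial_y f) p"
proof (induction b arbitrary: p)
  case (Suc b)
  obtain x y where p: "p = (x, y)" by (cases p)
  have "partial_y ((partial_x ^^ Suc b) f) p = partial_x (partial_y ((partial_x ^^ b) f)) p"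
    using mixed_partials_commute[OF smooth_on_higher_partial_x[OF assms(1)] assms(2)] Suc.prems p
    by simp
  also have "\<dots> = partial_x ((partial_x ^^ b) (partial_y f)) p"
    using Suc by (intro partial_x_cong[OF assms(2)]) auto
  finally show ?case by simp
qed auto

lemma higher_partials_commute:
  assumes "smooth_on f U" "open U"
  shows "p \<in> U \<Longrightarrow> (partial_y ^^ a) ((partial_x ^^ b) f) p = (partial_x ^^ b) ((partial_y ^^ a) f) p"
proof (induction a arbitrary: p)
  case (Suc a)
  have "(partial_y ^^ Suc a) ((partial_x ^^ b) f) p = partial_y ((partial_x ^^ b) ((partial_y ^^ a) f)) p"
    using Suc by (auto intro: partial_y_cong[OF assms(2)])
  also have "\<dots> = (partial_x ^^ b) ((partial_y ^^ Suc a) f) p"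
    using partial_y_higher_partial_x[OF smooth_on_higher_partial_y[OF assms(1)] assms(2)] Suc.prems
    by simp
  finally show ?case .
qed auto

text \<open>\<open>taylor_coeff\<close> takes the y-derivatives first, so exchanging the variables
  reverses the order of differentiation; smoothness near the origin allows it to be
  restored.\<close>

lemma taylor_coeff_swap:
  assumes "smooth_on f U" "open U" "(0, 0) \<in> U"
  shows "taylor_coeff (f \<circ> prod.swap) a b = taylor_coeff f b a"
  using higher_partials_commute[OF assms]
  by (simp add: taylor_coeff_def higher_partial_x_swap higher_partial_y_swap mult.commute)

section \<open>Taylor expansion with a uniform remainder on a box\<close>

lemma smooth_on_taylor_x:
  assumes f: "smooth_on f U" and box: "{-r..r} \<times> {-r..r} \<subseteq> U" and x: "\<bar>x\<bar> \<le> r"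
  shows "\<exists>\<xi>\<in>{-r..r}. f (x, 0) = (\<Sum>a<N. (partial_x ^^ a) f (0, 0) / fact a * x ^ a)
           + (partial_x ^^ N) f (\<xi>, 0) / fact N * x ^ N"
proof -
  have "\<exists>t. \<bar>t\<bar> \<le> \<bar>x\<bar> \<and> f (x, 0) = (\<Sum>a<N. (partial_x ^^ a) f (0, 0) / fact a * x ^ a)
           + (partial_x ^^ N) f (t, 0) / fact N * x ^ N"
  proof (rule Maclaurin_bi_le[where diff = "\<lambda>m t. (partial_x ^^ m) f (t, 0)"], safe)
    fix m t assume "\<bar>t\<bar> \<le> \<bar>x\<bar>"
    then have "(t, 0) \<in> {-r..r} \<times> {-r..r}" using x by auto
    then have "(t, 0) \<in> U" using box by blast
    then show "DERIV (\<lambda>t. (partial_x ^^ m) f (t, 0)) t :> (partial_x ^^ Suc m) f (t, 0)"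
      using smooth_on_DERIV_x[OF smooth_on_higher_partial_x[OF f]] by simp
  qed auto
  then show ?thesis using x by force
qed

lemma smooth_on_taylor_y:
  assumes f: "smooth_on f U" and box: "{-r..r} \<times> {-r..r} \<subseteq> U" and x: "\<bar>x\<bar> \<le> r" "\<bar>y\<bar> \<le> r"
  shows "\<exists>\<xi>\<in>{-r..r}. f (x, y) = (\<Sum>a<N. (partial_y ^^ a) f (x, 0) / fact a * y ^ a)
           + (partial_y ^^ N) f (x, \<xi>) / fact N * y ^ N"
proof -
  have "\<exists>t. \<bar>t\<bar> \<le> \<bar>y\<bar> \<and> f (x, y) = (\<Sum>a<N. (partial_y ^^ a) f (x, 0) / fact a * y ^ a)
           + (partial_y ^^ N) f (x, t) / fact N * y ^ N"
  proof (rule Maclaurin_bi_le[where diff = "\<lambda>m t. (partial_y ^^ m) f (x, t)"], safe)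
    fix m t assume "\<bar>t\<bar> \<le> \<bar>y\<bar>"
    then have "(x, t) \<in> {-r..r} \<times> {-r..r}" using x by auto
    then have "(x, t) \<in> U" using box by blast
    then show "DERIV (\<lambda>t. (partial_y ^^ m) f (x, t)) t :> (partial_y ^^ Suc m) f (x, t)"
      using smooth_on_DERIV_y[OF smooth_on_higher_partial_y[OF f]] by simp
  qed auto
  then show ?thesis using x by force
qed

lemma smooth_on_bounded_box:
  assumes f: "smooth_on f U" and box: "{-r..r::real} \<times> {-r..r} \<subseteq> U"
  obtains M where "M > 0" "\<And>x y. x \<in> {-r..r} \<Longrightarrow> y \<in> {-r..r} \<Longrightarrow> \<bar>f (x, y)\<bar> \<le> M"
proof -
  have "compact (f ` ({-r..r} \<times> {-r..r}))"
    by (intro compact_continuous_image continuous_on_subset[OF smooth_on_imp_continuous_on[OF f] box]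
          compact_Times compact_Icc)
  then obtain M where "M > 0" "\<And>z. z \<in> f ` ({-r..r} \<times> {-r..r}) \<Longrightarrow> norm z \<le> M"
    using compact_imp_bounded bounded_pos by metis
  then show ?thesis using that[of M] by auto
qed

text \<open>Expansion in y with x as a parameter, then of each coefficient in x along the axis y =
  0. This truncates to a square of exponents and leaves only pure powers as error, each of which can
  be compared with the supporting line.\<close>

lemma smooth_on_taylor:
  assumes f: "smooth_on f U" and box: "{-r..r::real} \<times> {-r..r} \<subseteq> U" and "r > 0"
  obtains C where "C > 0"
    "\<And>x y. \<bar>x\<bar> \<le> r \<Longrightarrow> \<bar>y\<bar> \<le> r \<Longrightarrow>
      \<bar>f (x, y) - (\<Sum>b<N. \<Sum>a<N. taylor_coeff f a b * x ^ a * y ^ b)\<bar> \<le> C * (\<bar>x\<bar> ^ N + \<bar>y\<bar> ^ N)"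
proof -
  obtain M where M: "M > 0" "\<And>x y. x \<in> {-r..r} \<Longrightarrow> y \<in> {-r..r} \<Longrightarrow> \<bar>(partial_y ^^ N) f (x, y)\<bar> \<le> M"
    using smooth_on_bounded_box[OF smooth_on_higher_partial_y[OF f] box] by metis
  have "\<forall>b. \<exists>L>0. \<forall>x\<in>{-r..r}. \<forall>y\<in>{-r..r}. \<bar>(partial_x ^^ N) ((partial_y ^^ b) f) (x, y)\<bar> \<le> L"
  proof
    fix b
    obtain L where "L > 0" "\<And>x y. x \<in> {-r..r} \<Longrightarrow> y \<in> {-r..r} \<Longrightarrow>
        \<bar>(partial_x ^^ N) ((partial_y ^^ b) f) (x, y)\<bar> \<le> L"
      using smooth_on_bounded_box[OF smooth_on_higher_partial_x[OF smooth_on_higher_partial_y[OF f]] box]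
      by metis
    then show "\<exists>L>0. \<forall>x\<in>{-r..r}. \<forall>y\<in>{-r..r}. \<bar>(partial_x ^^ N) ((partial_y ^^ b) f) (x, y)\<bar> \<le> L"
      by blast
  qed
  then obtain L where L: "\<And>b. L b > 0"
    "\<And>b x y. x \<in> {-r..r} \<Longrightarrow> y \<in> {-r..r} \<Longrightarrow> \<bar>(partial_x ^^ N) ((partial_y ^^ b) f) (x, y)\<bar> \<le> L b"
    by metis
  \<comment> \<open>\<open>L b\<close> bounds the x-remainder of the b-th coefficient, and
    \<open>r ^ b\<close> bounds the factor |y|^b that multiplies it.\<close>
  define C where "C = M + (\<Sum>b<N. L b * r ^ b)"
  have sum0: "(\<Sum>b<N. L b * r ^ b) \<ge> 0"
    using L(1) \<open>r > 0\<close> by (intro sum_nonneg mult_nonneg_nonneg zero_le_power) (auto intro: less_imp_le)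
  show ?thesis
  proof (rule that[of C])
    show "C > 0" using M(1) sum0 by (simp add: C_def)
    fix x y :: real assume xy: "\<bar>x\<bar> \<le> r" "\<bar>y\<bar> \<le> r"
    have fact_bound: "\<bar>z / fact n * t\<bar> \<le> B * \<bar>t\<bar>" if "\<bar>z\<bar> \<le> B" for z B t :: real and n
    proof -
      have "\<bar>z / fact n\<bar> \<le> \<bar>z\<bar>" by (simp add: divide_le_eq mult_le_cancel_left1 fact_ge_1)
      then show ?thesis using that by (metis abs_mult abs_ge_zero mult_right_mono order_trans)
    qed
    obtain \<eta> where \<eta>: "\<eta> \<in> {-r..r}"
      "f (x, y) = (\<Sum>b<N. (partial_y ^^ b) f (x, 0) / fact b * y ^ b)
           + (partial_y ^^ N) f (x, \<eta>) / fact N * y ^ N"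
      using smooth_on_taylor_y[OF f box xy] by blast
    have A: "\<bar>f (x, y) - (\<Sum>b<N. (partial_y ^^ b) f (x, 0) / fact b * y ^ b)\<bar> \<le> M * \<bar>y\<bar> ^ N"
      using fact_bound[OF M(2)[of x \<eta>], of N "y ^ N"] \<eta> xy by (simp add: abs_le_iff power_abs)
    have B: "\<bar>(partial_y ^^ b) f (x, 0) / fact b * y ^ b - (\<Sum>a<N. taylor_coeff f a b * x ^ a * y ^ b)\<bar>
        \<le> L b * r ^ b * \<bar>x\<bar> ^ N" for b
    proof -
      obtain \<xi> where \<xi>: "\<xi> \<in> {-r..r}"
        "(partial_y ^^ b) f (x, 0) = (\<Sum>a<N. (partial_x ^^ a) ((partial_y ^^ b) f) (0, 0) / fact a * x ^ a)
             + (partial_x ^^ N) ((partial_y ^^ b) f) (\<xi>, 0) / fact N * x ^ N"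
        using smooth_on_taylor_x[OF smooth_on_higher_partial_y[OF f] box xy(1)] by blast
      have "(partial_y ^^ b) f (x, 0) / fact b * y ^ b - (\<Sum>a<N. taylor_coeff f a b * x ^ a * y ^ b)
          = (partial_x ^^ N) ((partial_y ^^ b) f) (\<xi>, 0) / fact N * x ^ N / fact b * y ^ b"
        unfolding \<xi>(2) taylor_coeff_def
        by (simp add: add_divide_distrib sum_divide_distrib distrib_right sum_distrib_right)
      moreover have "\<bar>(partial_x ^^ N) ((partial_y ^^ b) f) (\<xi>, 0) / fact N * x ^ N\<bar> \<le> L b * \<bar>x\<bar> ^ N"
        using fact_bound[OF L(2)[of \<xi> 0 b], of N "x ^ N"] \<xi> \<open>r > 0\<close> by (simp add: power_abs)
      ultimately have "\<bar>(partial_y ^^ b) f (x, 0) / fact b * y ^ b - (\<Sum>a<N. taylor_coeff f a b * x ^ a * y ^ b)\<bar>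
          \<le> (L b * \<bar>x\<bar> ^ N) * \<bar>y\<bar> ^ b"
        using fact_bound[of "(partial_x ^^ N) ((partial_y ^^ b) f) (\<xi>, 0) / fact N * x ^ N" "L b * \<bar>x\<bar> ^ N" b "y ^ b"]
        by (simp add: power_abs)
      also have "\<dots> \<le> (L b * \<bar>x\<bar> ^ N) * r ^ b"
        using L(1)[of b] xy by (intro mult_left_mono power_mono) auto
      finally show ?thesis by (simp add: mult_ac)
    qed
    have "\<bar>(\<Sum>b<N. (partial_y ^^ b) f (x, 0) / fact b * y ^ b) - (\<Sum>b<N. \<Sum>a<N. taylor_coeff f a b * x ^ a * y ^ b)\<bar>
        \<le> (\<Sum>b<N. L b * r ^ b * \<bar>x\<bar> ^ N)"
      unfolding sum_subtractf[symmetric] by (rule order_trans[OF sum_abs sum_mono[OF B]])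
    also have "\<dots> = (\<Sum>b<N. L b * r ^ b) * \<bar>x\<bar> ^ N" by (simp add: sum_distrib_right)
    finally have "\<bar>f (x, y) - (\<Sum>b<N. \<Sum>a<N. taylor_coeff f a b * x ^ a * y ^ b)\<bar>
        \<le> M * \<bar>y\<bar> ^ N + (\<Sum>b<N. L b * r ^ b) * \<bar>x\<bar> ^ N"
      using A by linarith
    also have "\<dots> \<le> C * (\<bar>x\<bar> ^ N + \<bar>y\<bar> ^ N)"
      using M(1) sum0 by (simp add: C_def algebra_simps)
    finally show "\<bar>f (x, y) - (\<Sum>b<N. \<Sum>a<N. taylor_coeff f a b * x ^ a * y ^ b)\<bar>
        \<le> C * (\<bar>x\<bar> ^ N + \<bar>y\<bar> ^ N)" .
  qed
qed

subsection \<open>Sublevel sets of functions of one variable\<close>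

text \<open>
  The bound is stated with a free \<open>\<tau>\<close> satisfying \<open>\<eta> \<le> c \<tau>\<^bsup>k\<^esup>\<close> instead of
  \<open>\<tau> = (\<eta>/c)\<^bsup>1/k\<^esup>\<close>: then the induction can start at \<open>k = 0\<close>, and off an interval of radius
  \<open>\<tau>\<close> the derivative of order \<open>k\<close> exceeds \<open>c \<tau>\<close>.
\<close>

lemma van_der_corput_sublevel:
  fixes G :: "nat \<Rightarrow> real \<Rightarrow> real"
  assumes "c > 0" "\<tau> > 0" "\<eta> \<le> c * \<tau> ^ k"
    and "\<And>i t. i < k \<Longrightarrow> t \<in> {\<alpha>..\<beta>} \<Longrightarrow> (G i has_real_derivative G (Suc i) t) (at t)"
    and "\<And>t. t \<in> {\<alpha>..\<beta>} \<Longrightarrow> c \<le> G k t"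
  shows "\<exists>T\<in>sets lborel. {t\<in>{\<alpha>..\<beta>}. \<bar>G 0 t\<bar> < \<eta>} \<subseteq> T \<and>
           emeasure lborel T \<le> ennreal (2 * (2 ^ k - 1) * \<tau>)"
  using assms
proof (induction k arbitrary: G c \<alpha> \<beta>)
  case 0
  then have "{t\<in>{\<alpha>..\<beta>}. \<bar>G 0 t\<bar> < \<eta>} = {}" by fastforce
  then show ?case by (intro bexI[of _ "{}"]) auto
next
  case (Suc k)
  show ?case
  proof (cases "\<alpha> \<le> \<beta>")
    case False
    then show ?thesis by (intro bexI[of _ "{}"]) auto
  next
    case True
    have D: "(G k has_real_derivative G (Suc k) t) (at t)" if "t \<in> {\<alpha>..\<beta>}" for t
      using Suc.prems(4) that by blast
    have grow: "c * (t - s) \<le> G k t - G k s" if st: "s \<in> {\<alpha>..\<beta>}" "t \<in> {\<alpha>..\<beta>}" "s \<le> t" for s t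
    proof (cases "s = t")
      case False
      then have "\<exists>z>s. z < t \<and> G k t - G k s = (t - s) * G (Suc k) z"
        using st by (intro MVT2 D) auto
      then obtain z where "s < z" "z < t" "G k t - G k s = (t - s) * G (Suc k) z" by blast
      then show ?thesis using Suc.prems(5)[of z] st
        by (simp add: mult.commute mult_left_mono)
    qed auto
    have cont: "continuous_on {\<alpha>..\<beta>} (G k)"
      using D by (meson DERIV_isCont continuous_at_imp_continuous_on)
    \<comment> \<open>\<open>G k\<close> is increasing, so \<open>t0\<close> is a zero of it, or an
      endpoint when there is no change of sign. The disjunctions say that if the sign at
      \<open>t0\<close> is wrong for one side, then that side is empty.\<close>
    obtain t0 where t0: "t0 \<in> {\<alpha>..\<beta>}" "G k t0 \<ge> 0 \<or> t0 = \<beta>" "G k t0 \<le> 0 \<or> t0 = \<alpha>"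
    proof -
      consider "G k \<alpha> \<ge> 0" | "G k \<beta> \<le> 0" | "G k \<alpha> \<le> 0" "0 \<le> G k \<beta>" by linarith
      then show ?thesis
      proof cases
        case 3
        then obtain z where "z \<ge> \<alpha>" "z \<le> \<beta>" "G k z = 0"
          using IVT'[of "G k" \<alpha> 0 \<beta>] True cont by blast
        then show ?thesis using that[of z] by auto
      qed (use that[of \<alpha>] that[of \<beta>] True in auto)
    qed
    have pc: "c * \<tau> > 0" "\<eta> \<le> (c * \<tau>) * \<tau> ^ k"
      using Suc.prems by (auto simp: mult_ac)
    have "\<exists>T\<in>sets lborel. {t\<in>{t0 + \<tau>..\<beta>}. \<bar>G 0 t\<bar> < \<eta>} \<subseteq> T \<and>
           emeasure lborel T \<le> ennreal (2 * (2 ^ k - 1) * \<tau>)"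
    proof (rule Suc.IH[OF pc(1) Suc.prems(2) pc(2)])
      fix t assume t: "t \<in> {t0 + \<tau>..\<beta>}"
      then have "G k t0 \<ge> 0" using t0 Suc.prems(2) by auto
      moreover have "c * \<tau> \<le> c * (t - t0)" using t Suc.prems(1) by (intro mult_left_mono) auto
      ultimately show "c * \<tau> \<le> G k t" using grow[of t0 t] t t0 Suc.prems(2) by force
    qed (use Suc.prems(2,4) t0 in auto)
    then obtain T1 where T1: "T1 \<in> sets lborel" "{t\<in>{t0 + \<tau>..\<beta>}. \<bar>G 0 t\<bar> < \<eta>} \<subseteq> T1"
           "emeasure lborel T1 \<le> ennreal (2 * (2 ^ k - 1) * \<tau>)" by blast
    have "\<exists>T\<in>sets lborel. {t\<in>{\<alpha>..t0 - \<tau>}. \<bar>- G 0 t\<bar> < \<eta>} \<subseteq> T \<and>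
           emeasure lborel T \<le> ennreal (2 * (2 ^ k - 1) * \<tau>)"
    proof (rule Suc.IH[OF pc(1) Suc.prems(2) pc(2), where G = "\<lambda>i t. - G i t"])
      fix t assume t: "t \<in> {\<alpha>..t0 - \<tau>}"
      then have "G k t0 \<le> 0" using t0 Suc.prems(2) by auto
      moreover have "c * \<tau> \<le> c * (t0 - t)" using t Suc.prems(1) by (intro mult_left_mono) auto
      ultimately show "c * \<tau> \<le> - G k t" using grow[of t t0] t t0 Suc.prems(2) by force
    next
      fix i t assume "i < k" "t \<in> {\<alpha>..t0 - \<tau>}"
      then show "((\<lambda>t. - G i t) has_real_derivative - G (Suc i) t) (at t)"
        using Suc.prems(2,4) t0 by (intro DERIV_minus) auto
    qed
    then obtain T2 where T2: "T2 \<in> sets lborel" "{t\<in>{\<alpha>..t0 - \<tau>}. \<bar>G 0 t\<bar> < \<eta>} \<subseteq> T2"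
           "emeasure lborel T2 \<le> ennreal (2 * (2 ^ k - 1) * \<tau>)" by auto
    \<comment> \<open>Two side pieces and a middle interval of length \<open>2 * \<tau>\<close> give
      the recursion m(k+1) = 2 m(k) + 2 with m(0) = 0, whose solution is 2 (2^k - 1).\<close>
    let ?T = "T1 \<union> T2 \<union> {t0 - \<tau>..t0 + \<tau>}"
    have "emeasure lborel ?T \<le> emeasure lborel T1 + emeasure lborel T2 + emeasure lborel {t0 - \<tau>..t0 + \<tau>}"
      using T1(1) T2(1) by (intro order_trans[OF emeasure_subadditive] add_right_mono emeasure_subadditive) auto
    also have "\<dots> \<le> ennreal (2 * (2 ^ k - 1) * \<tau>) + ennreal (2 * (2 ^ k - 1) * \<tau>) + ennreal (2 * \<tau>)"
      using T1(3) T2(3) Suc.prems(2) by (intro add_mono) auto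
    also have "\<dots> = ennreal (2 * (2 ^ Suc k - 1) * \<tau>)"
      using Suc.prems(2) by (simp flip: ennreal_plus add: algebra_simps)
    finally have "emeasure lborel ?T \<le> ennreal (2 * (2 ^ Suc k - 1) * \<tau>)" .
    moreover have "{t\<in>{\<alpha>..\<beta>}. \<bar>G 0 t\<bar> < \<eta>} \<subseteq> ?T"
      using T1(2) T2(2) by (auto simp: subset_eq)
    ultimately show ?thesis using T1(1) T2(1) by (intro bexI[of _ ?T]) auto
  qed
qed

subsection \<open>Anisotropic rescaling\<close>

text \<open>
  The \<open>k\<close>-th derivative in \<open>v\<close> of the sum of the Taylor monomials \<open>s\<^sub>a\<^sub>b u\<^sup>a v\<^sup>b\<close> with
  \<open>p a + q b = w\<close>; the truncation at \<open>N\<close> is harmless once \<open>w < p N\<close> and \<open>w < q N\<close>.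
\<close>

definition scaled_deriv_limit ::
    "(real \<times> real \<Rightarrow> real) \<Rightarrow> real \<Rightarrow> real \<Rightarrow> real \<Rightarrow> nat \<Rightarrow> nat \<Rightarrow> real \<Rightarrow> real \<Rightarrow> real" where
  "scaled_deriv_limit S p q w N k u v =
     (\<Sum>b<N. \<Sum>a<N. if p * real a + q * real (b + k) = w
        then taylor_coeff ((partial_y ^^ k) S) a b * u ^ a * v ^ b else 0)"

lemma taylor_coeff_higher_partial_y:
  "taylor_coeff ((partial_y ^^ k) S) a b = taylor_coeff S a (b + k) * (fact (b + k) / fact b)"
  by (simp add: taylor_coeff_def funpow_add)

lemma tendsto_exp_neg_linear:
  assumes "c > (0::real)" shows "(\<lambda>j::nat. exp (- (c * real j))) \<longlonglongrightarrow> 0"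
proof -
  have "(\<lambda>j::nat. exp (-c) ^ j) \<longlonglongrightarrow> 0" using assms by (intro LIMSEQ_power_zero) auto
  then show ?thesis by (simp flip: exp_of_nat_mult add: mult.commute)
qed

text \<open>Under the dilation a Taylor monomial with excess \<open>\<delta> a b\<close> over the
  line is damped by \<open>exp (- (\<delta> a b * real j))\<close>. Negative excess is excluded by
  the support condition, zero excess gives the limit, positive excess dies out, and so does the
  remainder because x^N and y^N lie above the line. The radius 2 leaves room around the points of
  the unit box.\<close>

lemma scaled_deriv_uniform_limit:
  assumes S: "smooth_on S U" and U: "open U" "(0, 0) \<in> U"
    and pq: "p > 0" "q > 0"
    and supp: "\<And>a b. taylor_coeff S a b \<noteq> 0 \<Longrightarrow> w \<le> p * real a + q * real b"
    and N: "w < p * real N" "w < q * real N" and e: "e > 0"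
  shows "\<forall>\<^sub>F j in sequentially. \<forall>u v. \<bar>u\<bar> \<le> 2 \<longrightarrow> \<bar>v\<bar> \<le> 2 \<longrightarrow>
     \<bar>exp ((w - q * real k) * real j) * (partial_y ^^ k) S (exp (- p * real j) * u, exp (- q * real j) * v)
       - scaled_deriv_limit S p q w N k u v\<bar> < e"
proof -
  let ?G = "(partial_y ^^ k) S"
  let ?g = "taylor_coeff ?G"
  obtain r where r: "r > 0" "{-r..r} \<times> {-r..r} \<subseteq> U"
    using open_box_around[OF U] by auto
  obtain C where C: "C > 0" "\<And>x y. \<bar>x\<bar> \<le> r \<Longrightarrow> \<bar>y\<bar> \<le> r \<Longrightarrow>
      \<bar>?G (x, y) - (\<Sum>b<N. \<Sum>a<N. ?g a b * x ^ a * y ^ b)\<bar> \<le> C * (\<bar>x\<bar> ^ N + \<bar>y\<bar> ^ N)"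
    by (rule smooth_on_taylor[OF smooth_on_higher_partial_y[OF S, of k] r(2) r(1), of N]) blast
  define \<delta> where "\<delta> a b = p * real a + q * real (b + k) - w" for a b
  define h where "h j a b = (if \<delta> a b = 0 then 0 else \<bar>?g a b\<bar> * 2 ^ a * 2 ^ b * exp (- (\<delta> a b * real j)))" for j a b
  \<comment> \<open>A majorant of the error that does not involve u and v, which makes the
    convergence uniform.\<close>
  define H where "H j = C * 2 ^ N * (exp (- ((p * real N + q * real k - w) * real j)) + exp (- ((q * real N + q * real k - w) * real j)))
      + (\<Sum>b<N. \<Sum>a<N. h j a b)" for j
  have \<delta>: "\<delta> a b \<ge> 0" if "?g a b \<noteq> 0" for a b
    using that supp[of a "b + k"] by (auto simp: taylor_coeff_higher_partial_y \<delta>_def)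
  have h0: "(\<lambda>j. h j a b) \<longlonglongrightarrow> 0" for a b
  proof (cases "\<delta> a b = 0 \<or> ?g a b = 0")
    case False
    then have "\<delta> a b > 0" using \<delta>[of a b] by auto
    from tendsto_mult_right_zero[OF tendsto_exp_neg_linear[OF this]]
    show ?thesis using False by (simp add: h_def)
  next
    case True
    then have "h j a b = 0" for j by (auto simp: h_def)
    then show ?thesis by simp
  qed
  have pos: "p * real N + q * real k - w > 0" "q * real N + q * real k - w > 0"
    using N pq mult_nonneg_nonneg[of q "real k"] by linarith+
  have "H \<longlonglongrightarrow> C * 2 ^ N * (0 + 0) + (\<Sum>b<N. \<Sum>a<N. 0)"
    unfolding H_def by (intro tendsto_intros tendsto_exp_neg_linear pos h0)
  then have "H \<longlonglongrightarrow> 0" by simp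
  then have "\<forall>\<^sub>F j in sequentially. H j < e" using e by (rule order_tendstoD)
  moreover have "\<forall>\<^sub>F j in sequentially. exp (- p * real j) < r / 2"
    using order_tendstoD(2)[OF tendsto_exp_neg_linear[OF pq(1)], of "r / 2"] r by simp
  moreover have "\<forall>\<^sub>F j in sequentially. exp (- q * real j) < r / 2"
    using order_tendstoD(2)[OF tendsto_exp_neg_linear[OF pq(2)], of "r / 2"] r by simp
  ultimately show ?thesis
  proof eventually_elim
    case (elim j)
    show ?case
    proof (intro allI impI)
      fix u v :: real assume uv: "\<bar>u\<bar> \<le> 2" "\<bar>v\<bar> \<le> 2"
      let ?X = "exp (- p * real j)" and ?Y = "exp (- q * real j)"
      let ?W = "exp ((w - q * real k) * real j)"
      have xy: "\<bar>?X * u\<bar> \<le> ?X * 2" "\<bar>?Y * v\<bar> \<le> ?Y * 2" using uv by (auto simp: abs_mult)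
      have "\<bar>?G (?X * u, ?Y * v) - (\<Sum>b<N. \<Sum>a<N. ?g a b * (?X * u) ^ a * (?Y * v) ^ b)\<bar>
          \<le> C * (\<bar>?X * u\<bar> ^ N + \<bar>?Y * v\<bar> ^ N)"
        using xy elim by (intro C(2)) auto
      also have "\<dots> \<le> C * ((?X * 2) ^ N + (?Y * 2) ^ N)"
        using xy C(1) by (intro mult_left_mono add_mono power_mono) auto
      finally have "?W * \<bar>?G (?X * u, ?Y * v) - (\<Sum>b<N. \<Sum>a<N. ?g a b * (?X * u) ^ a * (?Y * v) ^ b)\<bar>
          \<le> ?W * (C * ((?X * 2) ^ N + (?Y * 2) ^ N))"
        by (intro mult_left_mono) auto
      then have 1: "\<bar>?W * ?G (?X * u, ?Y * v) - ?W * (\<Sum>b<N. \<Sum>a<N. ?g a b * (?X * u) ^ a * (?Y * v) ^ b)\<bar>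
          \<le> ?W * (C * ((?X * 2) ^ N + (?Y * 2) ^ N))"
        by (simp add: abs_mult flip: right_diff_distrib)
      have 2: "?W * (C * ((?X * 2) ^ N + (?Y * 2) ^ N)) =
          C * 2 ^ N * (exp (- ((p * real N + q * real k - w) * real j)) + exp (- ((q * real N + q * real k - w) * real j)))"
      proof -
        have "?W * ?X ^ N = exp (- ((p * real N + q * real k - w) * real j))"
          by (simp flip: exp_of_nat_mult exp_add add: algebra_simps)
        moreover have "?W * ?Y ^ N = exp (- ((q * real N + q * real k - w) * real j))"
          by (simp flip: exp_of_nat_mult exp_add add: algebra_simps)
        ultimately show ?thesis by (simp add: power_mult_distrib algebra_simps)
      qed
      have t: "?W * (?g a b * (?X * u) ^ a * (?Y * v) ^ b) = ?g a b * u ^ a * v ^ b * exp (- (\<delta> a b * real j))" for a b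
      proof -
        have "?W * ?X ^ a * ?Y ^ b = exp (- (\<delta> a b * real j))"
          by (simp flip: exp_of_nat_mult exp_add add: algebra_simps \<delta>_def)
        then show ?thesis by (simp add: power_mult_distrib mult_ac)
      qed
      have 3: "\<bar>?g a b * u ^ a * v ^ b * exp (- (\<delta> a b * real j))
          - (if \<delta> a b = 0 then ?g a b * u ^ a * v ^ b else 0)\<bar> \<le> h j a b" for a b
      proof (cases "\<delta> a b = 0")
        case False
        have "\<bar>?g a b * u ^ a * v ^ b\<bar> \<le> \<bar>?g a b\<bar> * 2 ^ a * 2 ^ b"
          unfolding abs_mult power_abs using uv by (intro mult_mono power_mono) auto
        then show ?thesis using False by (simp add: h_def abs_mult mult_right_mono)
      qed (auto simp: h_def)
      have D: "scaled_deriv_limit S p q w N k u v = (\<Sum>b<N. \<Sum>a<N. if \<delta> a b = 0 then ?g a b * u ^ a * v ^ b else 0)"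
        unfolding scaled_deriv_limit_def \<delta>_def by (intro sum.cong refl if_cong) auto
      have 4: "\<bar>?W * (\<Sum>b<N. \<Sum>a<N. ?g a b * (?X * u) ^ a * (?Y * v) ^ b) - scaled_deriv_limit S p q w N k u v\<bar>
          \<le> (\<Sum>b<N. \<Sum>a<N. h j a b)"
        unfolding sum_distrib_left t D sum_subtractf[symmetric]
        by (rule order_trans[OF sum_abs sum_mono], rule order_trans[OF sum_abs sum_mono], rule 3)
      show "\<bar>?W * ?G (?X * u, ?Y * v) - scaled_deriv_limit S p q w N k u v\<bar> < e"
        using 1 4 elim(1) unfolding 2 H_def by linarith
    qed
  qed
qed


section \<open>Measure of sublevel sets at a single scale\<close>

lemma emeasure_lborel_le_slices:
  fixes M :: "(real \<times> real) set"
  assumes M: "M \<in> sets borel" and B: "B \<ge> 0" "\<alpha> \<le> \<beta>"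
    and slice: "\<And>x. x \<in> {\<alpha>..\<beta>} \<Longrightarrow> emeasure lborel (Pair x -` M) \<le> ennreal B"
    and empty: "\<And>x. x \<notin> {\<alpha>..\<beta>} \<Longrightarrow> Pair x -` M = {}"
  shows "emeasure lborel M \<le> ennreal (B * (\<beta> - \<alpha>))"
proof -
  have "M \<in> sets (lborel \<Otimes>\<^sub>M lborel)" using M unfolding lborel_prod by simp
  then have "emeasure (lborel \<Otimes>\<^sub>M lborel) M = (\<integral>\<^sup>+x. emeasure lborel (Pair x -` M) \<partial>lborel)"
    by (rule lborel.emeasure_pair_measure_alt)
  also have "\<dots> \<le> (\<integral>\<^sup>+x. ennreal B * indicator {\<alpha>..\<beta>} x \<partial>lborel)"
  proof (intro nn_integral_mono)
    fix x :: real
    show "emeasure lborel (Pair x -` M) \<le> ennreal B * indicator {\<alpha>..\<beta>} x"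
      using slice[of x] empty[of x] by (cases "x \<in> {\<alpha>..\<beta>}") auto
  qed
  also have "\<dots> = ennreal B * emeasure lborel {\<alpha>..\<beta>}"
    by (rule nn_integral_cmult_indicator) auto
  also have "\<dots> = ennreal (B * (\<beta> - \<alpha>))"
    using B by (simp add: ennreal_mult')
  finally show ?thesis by (simp add: lborel_prod)
qed

lemma isCont_scaled_deriv_limit:
  "isCont (\<lambda>z. scaled_deriv_limit S p q w N k (fst z) (snd z)) z"
proof -
  have "isCont (\<lambda>z. if c then taylor_coeff ((partial_y ^^ k) S) a b * fst z ^ a * snd z ^ b else 0) z"
    for c a b by (cases c) auto
  then show ?thesis unfolding scaled_deriv_limit_def by (intro continuous_intros)
qed

text \<open>The inverse of the j-th dilation: it magnifies that scale to unit size.\<close>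

definition rescale :: "real \<Rightarrow> real \<Rightarrow> nat \<Rightarrow> real \<times> real \<Rightarrow> real \<times> real" where
  "rescale p q j z = (exp (p * real j) * fst z, exp (q * real j) * snd z)"

text \<open>At scale j the phase is \<open>exp (- w * real j)\<close> times a nearly fixed function,
  so the effective level is \<open>\<epsilon> * exp (w * real j)\<close>; 1/K is the van der Corput
  exponent and the last factor is the Jacobian. One C serves all \<open>\<epsilon>\<close> and all
  large j, so that the scales can be summed.\<close>

definition local_bound ::
  "(real \<times> real \<Rightarrow> real) \<Rightarrow> (real \<times> real) set \<Rightarrow> real \<Rightarrow> real \<Rightarrow> real \<Rightarrow> nat \<Rightarrow> (real \<times> real) set \<Rightarrow> bool" where
  "local_bound S U p q w K A \<longleftrightarrow> (\<exists>C>0. \<forall>\<^sub>F j in sequentially. \<forall>\<epsilon>>0.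
     emeasure lborel {z\<in>U. rescale p q j z \<in> A \<and> \<bar>S z\<bar> < \<epsilon>}
       \<le> ennreal (C * (\<epsilon> * exp (w * real j)) powr (1 / real K) * exp (- (p + q) * real j)))"

lemma sublevel_measurable:
  fixes S :: "real \<times> real \<Rightarrow> real"
  assumes S: "continuous_on U S" and U: "open U" and A: "A \<in> sets borel"
  shows "{z\<in>U. rescale p q j z \<in> A \<and> \<bar>S z\<bar> < \<epsilon>} \<in> sets borel"
proof -
  have "open (U \<inter> S -` {-\<epsilon><..<\<epsilon>})"
    using continuous_on_open_vimage[OF U] S by (metis Int_commute open_greaterThanLessThan)
  moreover have "rescale p q j -` A \<in> sets borel"
  proof -
    have "rescale p q j \<in> borel_measurable borel"
      unfolding rescale_def by (intro borel_measurable_continuous_onI continuous_intros)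
    from measurable_sets[OF this A] show ?thesis by simp
  qed
  ultimately have "(U \<inter> S -` {-\<epsilon><..<\<epsilon>}) \<inter> rescale p q j -` A \<in> sets borel"
    using sets.Int[OF borel_open] by blast
  moreover have "{z\<in>U. rescale p q j z \<in> A \<and> \<bar>S z\<bar> < \<epsilon>} = (U \<inter> S -` {-\<epsilon><..<\<epsilon>}) \<inter> rescale p q j -` A"
    by auto
  ultimately show ?thesis by simp
qed

text \<open>Near the given point the normalised k-th y-derivative is bounded below at all large
  scales, so van der Corput applies on every vertical slice and Tonelli collects the slices. Since k
  may be smaller than K, the exponent 1/K comes from van der Corput only for small rescaled levels;
  for the others the trivial bound by the box suffices.\<close>

lemma local_bound_y:
  assumes S: "smooth_on S U" and U: "open U" "(0, 0) \<in> U"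
    and pq: "p > 0" "q > 0"
    and supp: "\<And>a b. taylor_coeff S a b \<noteq> 0 \<Longrightarrow> w \<le> p * real a + q * real b"
    and N: "w < p * real N" "w < q * real N"
    and K: "K \<ge> 1" "k \<le> K"
    and z: "\<bar>u0\<bar> \<le> 1" "\<bar>v0\<bar> \<le> 1" and D: "scaled_deriv_limit S p q w N k u0 v0 \<noteq> 0"
  shows "\<exists>\<delta>>0. local_bound S U p q w K ({u0 - \<delta><..<u0 + \<delta>} \<times> {v0 - \<delta><..<v0 + \<delta>})"
proof -
  let ?D = "scaled_deriv_limit S p q w N k"
  define s where "s = sgn (?D u0 v0)"
  \<comment> \<open>A quarter, because the limit may vary by \<open>2 * c\<close> over the box and
    the rescaled derivative may differ from it by another c, which still leaves c.\<close>
  define c where "c = \<bar>?D u0 v0\<bar> / 4"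
  have c: "c > 0" using D by (simp add: c_def)
  have s: "\<bar>s\<bar> = 1" using D by (simp add: s_def abs_sgn_eq)
  have "\<forall>\<^sub>F z in at (u0, v0). dist (?D (fst z) (snd z)) (?D u0 v0) < 2 * c"
    using tendstoD[OF isCont_scaled_deriv_limit[where z = "(u0, v0)", unfolded isCont_def], of "2 * c" S p q w N k] c
    by simp
  then obtain d where d: "d > 0" "\<And>z. z \<noteq> (u0, v0) \<Longrightarrow> dist z (u0, v0) < d \<Longrightarrow>
      dist (?D (fst z) (snd z)) (?D u0 v0) < 2 * c"
    unfolding eventually_at by auto
  \<comment> \<open>At most 1, so that a box around a point of the unit box stays within radius 2,
    where the convergence is uniform.\<close>
  define \<delta> where "\<delta> = min 1 (d / 3)"
  have \<delta>: "\<delta> > 0" "\<delta> \<le> 1" "\<delta> \<le> d / 3" using d(1) by (auto simp: \<delta>_def)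
  have D2: "2 * c \<le> s * ?D u v" if "u \<in> {u0 - \<delta>..u0 + \<delta>}" "v \<in> {v0 - \<delta>..v0 + \<delta>}" for u v
  proof -
    have "dist (u, v) (u0, v0) \<le> \<bar>u - u0\<bar> + \<bar>v - v0\<bar>"
      unfolding dist_prod_def using sqrt_sum_squares_le_sum_abs[of "u - u0" "v - v0"]
      by (simp add: dist_real_def)
    moreover have "\<bar>u - u0\<bar> \<le> \<delta>" "\<bar>v - v0\<bar> \<le> \<delta>" using that by auto
    ultimately have "dist (u, v) (u0, v0) < d" using \<delta> d(1) by linarith
    then have "\<bar>?D u v - ?D u0 v0\<bar> < 2 * c"
      using d(2)[of "(u, v)"] c by (cases "(u, v) = (u0, v0)") (auto simp: dist_real_def)
    moreover have "s * ?D u0 v0 = 4 * c" by (simp add: s_def c_def sgn_mult_self_eq abs_sgn mult.commute)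
    moreover have "\<bar>s * ?D u v - s * ?D u0 v0\<bar> = \<bar>?D u v - ?D u0 v0\<bar>"
      using s by (simp add: abs_mult flip: right_diff_distrib)
    ultimately show ?thesis by linarith
  qed
  obtain r where r: "r > 0" "{-r..r} \<times> {-r..r} \<subseteq> U"
    using open_box_around[OF U] by auto
  let ?A = "{u0 - \<delta><..<u0 + \<delta>} \<times> {v0 - \<delta><..<v0 + \<delta>}"
  \<comment> \<open>\<open>2 * 2 ^ K\<close> dominates the van der Corput constant for every
    \<open>k \<le> K\<close>, and also the rescaled side length \<open>2 * \<delta>\<close>.\<close>
  define C where "C = 2 * 2 ^ K * (2 / c) powr (1 / real K)"
  have C: "C > 0" using c by (simp add: C_def)
  have "\<forall>\<^sub>F j in sequentially. exp (- p * real j) < r / 2"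
    using order_tendstoD(2)[OF tendsto_exp_neg_linear[OF pq(1)], of "r / 2"] r by simp
  moreover have "\<forall>\<^sub>F j in sequentially. exp (- q * real j) < r / 2"
    using order_tendstoD(2)[OF tendsto_exp_neg_linear[OF pq(2)], of "r / 2"] r by simp
  moreover have "\<forall>\<^sub>F j in sequentially. \<forall>u v. \<bar>u\<bar> \<le> 2 \<longrightarrow> \<bar>v\<bar> \<le> 2 \<longrightarrow>
     \<bar>exp ((w - q * real k) * real j) * (partial_y ^^ k) S (exp (- p * real j) * u, exp (- q * real j) * v) - ?D u v\<bar> < c"
    by (rule scaled_deriv_uniform_limit[OF S U pq _ N c]) (rule supp)
  ultimately have "\<forall>\<^sub>F j in sequentially. \<forall>\<epsilon>>0.
     emeasure lborel {z\<in>U. rescale p q j z \<in> ?A \<and> \<bar>S z\<bar> < \<epsilon>}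
       \<le> ennreal (2 * C * (\<epsilon> * exp (w * real j)) powr (1 / real K) * exp (- (p + q) * real j))"
  proof eventually_elim
    case (elim j)
    let ?X = "exp (- p * real j)" and ?Y = "exp (- q * real j)"
    show ?case
    proof (intro allI impI)
      fix \<epsilon> :: real assume \<epsilon>: "\<epsilon> > 0"
      define t where "t = \<epsilon> * exp (w * real j)"
      have t: "t > 0" using \<epsilon> by (simp add: t_def)
      define M where "M = {z\<in>U. rescale p q j z \<in> ?A \<and> \<bar>S z\<bar> < \<epsilon>}"
      have M: "M \<in> sets borel" unfolding M_def
        by (rule sublevel_measurable[OF smooth_on_imp_continuous_on[OF S] U(1)])
            (intro borel_open open_Times open_greaterThanLessThan)
      have XX: "exp (p * real j) * x = x / ?X" "exp (q * real j) * x = x / ?Y" for x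
        by (simp_all add: exp_minus field_simps)
      have sc: "e > 0 \<Longrightarrow> t / e \<in> {a - \<delta><..<a + \<delta>} \<Longrightarrow> t \<in> {e * (a - \<delta>)..e * (a + \<delta>)}"
        "e > 0 \<Longrightarrow> t \<in> {e * (a - \<delta>)..e * (a + \<delta>)} \<Longrightarrow> t / e \<in> {a - \<delta>..a + \<delta>}" for e t a
        by (auto simp: field_simps)
      have Mx: "x \<in> {?X * (u0 - \<delta>)..?X * (u0 + \<delta>)}" "y \<in> {?Y * (v0 - \<delta>)..?Y * (v0 + \<delta>)}"
        if "(x, y) \<in> M" for x y
        using that sc(1) unfolding M_def rescale_def XX by auto
      have slice: "emeasure lborel (Pair x -` M) \<le> ennreal (C * t powr (1 / real K) * ?Y)"
        if x: "x \<in> {?X * (u0 - \<delta>)..?X * (u0 + \<delta>)}" for x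
      proof (cases "t < c / 2")
        case False
        have "Pair x -` M \<subseteq> {?Y * (v0 - \<delta>)..?Y * (v0 + \<delta>)}" using Mx by blast
        then have "emeasure lborel (Pair x -` M) \<le> emeasure lborel {?Y * (v0 - \<delta>)..?Y * (v0 + \<delta>)}"
          by (intro emeasure_mono) auto
        also have "\<dots> = ennreal (2 * \<delta> * ?Y)"
          using \<delta> by (subst emeasure_lborel_Icc) (auto simp: algebra_simps mult_left_mono)
        also have "\<dots> \<le> ennreal (C * t powr (1 / real K) * ?Y)"
        proof (intro ennreal_leI mult_right_mono)
          have "1 \<le> (2 / c * t) powr (1 / real K)"
            using False c by (intro ge_one_powr_ge_zero) (auto simp: field_simps)
          then have "1 \<le> (2 / c) powr (1 / real K) * t powr (1 / real K)"
            using c t by (subst (asm) powr_mult) auto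
          moreover have "2 * 1 \<le> 2 * (2::real) ^ K" by (intro mult_left_mono) auto
          ultimately have "2 * 1 * 1 \<le> 2 * 2 ^ K * ((2 / c) powr (1 / real K) * t powr (1 / real K))"
            by (intro mult_mono) auto
          then show "2 * \<delta> \<le> C * t powr (1 / real K)" using \<delta>(2) by (simp add: C_def mult_ac)
        qed auto
        finally show ?thesis .
      next
        case True
        \<comment> \<open>The interval radius in rescaled units. As it is at most 1, its k-th power
          is at least its K-th power, which equals \<open>2 / c * t\<close>; in this way a
          derivative of lower order still yields the exponent 1/K.\<close>
        define \<theta> where "\<theta> = (2 / c * t) powr (1 / real K)"
        have \<theta>: "0 < \<theta>" "\<theta> \<le> 1"
          using True c t by (auto simp: \<theta>_def field_simps intro!: powr_le1)
        have \<theta>k: "2 / c * t \<le> \<theta> ^ k"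
        proof -
          have "\<theta> ^ K \<le> \<theta> ^ k" using \<theta> K by (intro power_decreasing) auto
          moreover have "\<theta> ^ K = 2 / c * t"
            using c t K by (simp add: \<theta>_def powr_powr flip: powr_realpow)
          ultimately show ?thesis by simp
        qed
        have ux: "x / ?X \<in> {u0 - \<delta>..u0 + \<delta>}" using x by (intro sc(2)) auto
        have "\<exists>T\<in>sets lborel. {y\<in>{?Y * (v0 - \<delta>)..?Y * (v0 + \<delta>)}. \<bar>s * S (x, y)\<bar> < \<epsilon>} \<subseteq> T \<and>
           emeasure lborel T \<le> ennreal (2 * (2 ^ k - 1) * (?Y * \<theta>))"
        proof (rule van_der_corput_sublevel[where G = "\<lambda>i y. s * (partial_y ^^ i) S (x, y)", simplified funpow_0])
          \<comment> \<open>The lower bound c for the normalised derivative, converted back to the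
            variable y.\<close>
          show "c * exp (- ((w - q * real k) * real j)) > 0" using c by simp
          show "?Y * \<theta> > 0" using \<theta> by simp
          have "c * exp (- ((w - q * real k) * real j)) * (?Y * \<theta>) ^ k
              = c * \<theta> ^ k * (exp (- ((w - q * real k) * real j)) * ?Y ^ k)"
            by (simp add: power_mult_distrib)
          also have "exp (- ((w - q * real k) * real j)) * ?Y ^ k = exp (- (w * real j))"
            by (simp flip: exp_of_nat_mult exp_add add: algebra_simps)
          finally have "c * exp (- ((w - q * real k) * real j)) * (?Y * \<theta>) ^ k = c * \<theta> ^ k * exp (- (w * real j))" .
          moreover have "c * (2 / c * t) * exp (- (w * real j)) \<le> c * \<theta> ^ k * exp (- (w * real j))"
            using \<theta>k c by (intro mult_right_mono mult_left_mono) auto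
          moreover have "c * (2 / c * t) * exp (- (w * real j)) = 2 * \<epsilon>"
            using c by (simp add: t_def exp_minus field_simps)
          ultimately show "\<epsilon> \<le> c * exp (- ((w - q * real k) * real j)) * (?Y * \<theta>) ^ k"
            using \<epsilon> by linarith
        next
          fix i y assume y: "y \<in> {?Y * (v0 - \<delta>)..?Y * (v0 + \<delta>)}"
          have vy: "y / ?Y \<in> {v0 - \<delta>..v0 + \<delta>}" using y by (intro sc(2)) auto
          have "\<bar>x / ?X\<bar> \<le> 2" "\<bar>y / ?Y\<bar> \<le> 2" using ux vy \<delta> z by auto
          then have "\<bar>x\<bar> \<le> ?X * 2" "\<bar>y\<bar> \<le> ?Y * 2" by (auto simp: abs_divide field_simps)
          then have "(x, y) \<in> {-r..r} \<times> {-r..r}" using elim(1,2) by auto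
          then have "(x, y) \<in> U" using r(2) by blast
          from DERIV_cmult[OF smooth_on_DERIV_y[OF smooth_on_higher_partial_y[OF S] this], of s i]
          show "((\<lambda>y. s * (partial_y ^^ i) S (x, y)) has_real_derivative s * (partial_y ^^ Suc i) S (x, y)) (at y)"
            by simp
        next
          fix y assume y: "y \<in> {?Y * (v0 - \<delta>)..?Y * (v0 + \<delta>)}"
          have vy: "y / ?Y \<in> {v0 - \<delta>..v0 + \<delta>}" using y by (intro sc(2)) auto
          have "\<bar>x / ?X\<bar> \<le> 2" "\<bar>y / ?Y\<bar> \<le> 2" using ux vy \<delta> z by auto
          with elim(3) have "\<bar>exp ((w - q * real k) * real j) * (partial_y ^^ k) S (?X * (x / ?X), ?Y * (y / ?Y))
              - ?D (x / ?X) (y / ?Y)\<bar> < c" by blast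
          then have lt: "\<bar>exp ((w - q * real k) * real j) * (partial_y ^^ k) S (x, y) - ?D (x / ?X) (y / ?Y)\<bar> < c"
            by simp
          have "\<bar>s * (exp ((w - q * real k) * real j) * (partial_y ^^ k) S (x, y)) - s * ?D (x / ?X) (y / ?Y)\<bar> < c"
            using lt s by (simp add: abs_mult flip: right_diff_distrib)
          with D2[OF ux vy] have "c \<le> s * (exp ((w - q * real k) * real j) * (partial_y ^^ k) S (x, y))"
            by linarith
          moreover have inv: "exp (- a) * (s * (exp a * g)) = s * g" for a g :: real
            by (simp add: exp_minus)
          ultimately have "exp (- ((w - q * real k) * real j)) * c \<le> exp (- ((w - q * real k) * real j)) *
              (s * (exp ((w - q * real k) * real j) * (partial_y ^^ k) S (x, y)))"
            by (intro mult_left_mono) auto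
          then show "c * exp (- ((w - q * real k) * real j)) \<le> s * (partial_y ^^ k) S (x, y)"
            unfolding inv by (simp only: mult.commute)
        qed
        then obtain T where T: "T \<in> sets lborel" "emeasure lborel T \<le> ennreal (2 * (2 ^ k - 1) * (?Y * \<theta>))"
          "{y\<in>{?Y * (v0 - \<delta>)..?Y * (v0 + \<delta>)}. \<bar>s * S (x, y)\<bar> < \<epsilon>} \<subseteq> T" by blast
        have "Pair x -` M \<subseteq> {y\<in>{?Y * (v0 - \<delta>)..?Y * (v0 + \<delta>)}. \<bar>s * S (x, y)\<bar> < \<epsilon>}"
          using Mx s by (auto simp: abs_mult) (auto simp: M_def)
        then have "emeasure lborel (Pair x -` M) \<le> emeasure lborel T"
          using T(1,3) by (intro emeasure_mono) auto
        also note T(2)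
        also have "ennreal (2 * (2 ^ k - 1) * (?Y * \<theta>)) \<le> ennreal (C * t powr (1 / real K) * ?Y)"
        proof (intro ennreal_leI)
          have "(2::real) ^ k - 1 \<le> 2 ^ K" 
            using power_increasing[OF K(2), of "2::real"] by linarith
          then have "2 * (2 ^ k - 1) * (?Y * \<theta>) \<le> 2 * 2 ^ K * (?Y * \<theta>)"
            using \<theta> by (intro mult_right_mono mult_left_mono) auto
          also have "\<dots> = C * t powr (1 / real K) * ?Y"
            using c t unfolding C_def \<theta>_def by (subst powr_mult) auto
          finally show "2 * (2 ^ k - 1) * (?Y * \<theta>) \<le> C * t powr (1 / real K) * ?Y" .
        qed
        finally show ?thesis .
      qed
      have "emeasure lborel M \<le> ennreal (C * t powr (1 / real K) * ?Y * (?X * (u0 + \<delta>) - ?X * (u0 - \<delta>)))"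
      proof (rule emeasure_lborel_le_slices[OF M _ _ slice])
        show "?X * (u0 - \<delta>) \<le> ?X * (u0 + \<delta>)" using \<delta> by simp
        show "Pair x -` M = {}" if "x \<notin> {?X * (u0 - \<delta>)..?X * (u0 + \<delta>)}" for x
          using that Mx(1) by blast
      qed (use C in auto)
      also have "\<dots> \<le> ennreal (2 * C * t powr (1 / real K) * exp (- (p + q) * real j))"
      proof (rule ennreal_leI)
        have "C * t powr (1 / real K) * ?Y * (?X * (u0 + \<delta>) - ?X * (u0 - \<delta>))
            = (C * t powr (1 / real K) * (?Y * ?X) * 2) * \<delta>"
          by (simp add: algebra_simps)
        also have "\<dots> \<le> (C * t powr (1 / real K) * (?Y * ?X) * 2) * 1"
          using C \<delta> by (intro mult_left_mono) auto
        also have "?Y * ?X = exp (- (p + q) * real j)" by (simp flip: exp_add add: algebra_simps)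
        finally show "C * t powr (1 / real K) * ?Y * (?X * (u0 + \<delta>) - ?X * (u0 - \<delta>))
           \<le> 2 * C * t powr (1 / real K) * exp (- (p + q) * real j)" by (simp add: mult_ac)
      qed
      finally show "emeasure lborel {z\<in>U. rescale p q j z \<in> ?A \<and> \<bar>S z\<bar> < \<epsilon>}
          \<le> ennreal (2 * C * (\<epsilon> * exp (w * real j)) powr (1 / real K) * exp (- (p + q) * real j))"
        by (simp add: M_def t_def)
    qed
  qed
  then show ?thesis unfolding local_bound_def using C \<delta>(1)
    by (intro exI[of _ \<delta>] conjI exI[of _ "2 * C"]) auto
qed

section \<open>Exchange of the two coordinates\<close>

lemma emeasure_lborel_swap:
  fixes M :: "(real \<times> real) set"
  assumes "M \<in> sets borel"
  shows "emeasure lborel (prod.swap -` M) = emeasure lborel M"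
proof -
  have M: "M \<in> sets (lborel \<Otimes>\<^sub>M lborel)" using assms unfolding lborel_prod by simp
  have sw: "prod.swap = (\<lambda>(x::real, y::real). (y, x))" by (auto simp: fun_eq_iff)
  have "emeasure (lborel \<Otimes>\<^sub>M lborel) M
      = emeasure (distr (lborel \<Otimes>\<^sub>M lborel) (lborel \<Otimes>\<^sub>M lborel) (\<lambda>(x::real, y::real). (y, x))) M"
    using lborel_pair.distr_pair_swap[where ?'a = real and ?'b = real] by simp
  also have "\<dots> = emeasure (lborel \<Otimes>\<^sub>M lborel) ((\<lambda>(x, y). (y, x)) -` M \<inter> space (lborel \<Otimes>\<^sub>M lborel))"
    by (rule emeasure_distr[OF measurable_pair_swap' M])
  finally show ?thesis by (simp add: sw lborel_prod space_pair_measure)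
qed

lemma local_bound_swap:
  assumes S: "continuous_on U S" and U: "open U" and A: "A \<in> sets borel"
    and lb: "local_bound (S \<circ> prod.swap) (prod.swap ` U) q p w K (prod.swap ` A)"
  shows "local_bound S U p q w K A"
proof -
  have "{z \<in> prod.swap ` U. rescale q p j z \<in> prod.swap ` A \<and> \<bar>(S \<circ> prod.swap) z\<bar> < \<epsilon>}
      = prod.swap -` {z\<in>U. rescale p q j z \<in> A \<and> \<bar>S z\<bar> < \<epsilon>}" for j \<epsilon>
    by (force simp: rescale_def image_iff)
  then have "emeasure lborel {z \<in> prod.swap ` U. rescale q p j z \<in> prod.swap ` A \<and> \<bar>(S \<circ> prod.swap) z\<bar> < \<epsilon>}
      = emeasure lborel {z\<in>U. rescale p q j z \<in> A \<and> \<bar>S z\<bar> < \<epsilon>}" for j \<epsilon>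
    using emeasure_lborel_swap[OF sublevel_measurable[OF S U A]] by simp
  with lb show ?thesis unfolding local_bound_def by (simp add: add.commute)
qed

text \<open>Serves the points with u = 0, where the y-derivatives of the limit may all vanish. The
  weights change places together with the coordinates.\<close>

lemma local_bound_x:
  assumes S: "smooth_on S U" and U: "open U" "(0, 0) \<in> U"
    and pq: "p > 0" "q > 0"
    and supp: "\<And>a b. taylor_coeff S a b \<noteq> 0 \<Longrightarrow> w \<le> p * real a + q * real b"
    and N: "w < p * real N" "w < q * real N"
    and K: "K \<ge> 1" "k \<le> K"
    and z: "\<bar>u0\<bar> \<le> 1" "\<bar>v0\<bar> \<le> 1" and D: "scaled_deriv_limit (S \<circ> prod.swap) q p w N k v0 u0 \<noteq> 0"
  shows "\<exists>\<delta>>0. local_bound S U p q w K ({u0 - \<delta><..<u0 + \<delta>} \<times> {v0 - \<delta><..<v0 + \<delta>})"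
proof -
  have "prod.swap ` U = prod.swap -` U" by force
  then have U': "open (prod.swap ` U)"
    using open_vimage[OF U(1), of prod.swap] continuous_on_swap by auto
  have "\<exists>\<delta>>0. local_bound (S \<circ> prod.swap) (prod.swap ` U) q p w K ({v0 - \<delta><..<v0 + \<delta>} \<times> {u0 - \<delta><..<u0 + \<delta>})"
  proof (rule local_bound_y[OF smooth_on_swap[OF S] U' _ pq(2,1) _ N(2,1) K z(2,1) D])
    show "(0, 0) \<in> prod.swap ` U" using U(2) by force
    show "w \<le> q * real a + p * real b" if "taylor_coeff (S \<circ> prod.swap) a b \<noteq> 0" for a b
      using that supp[of b a] unfolding taylor_coeff_swap[OF S U] by (simp add: add.commute)
  qed
  then obtain \<delta> where \<delta>: "\<delta> > 0"
    "local_bound (S \<circ> prod.swap) (prod.swap ` U) q p w K ({v0 - \<delta><..<v0 + \<delta>} \<times> {u0 - \<delta><..<u0 + \<delta>})" by blast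
  have "prod.swap ` ({u0 - \<delta><..<u0 + \<delta>} \<times> {v0 - \<delta><..<v0 + \<delta>}) = {v0 - \<delta><..<v0 + \<delta>} \<times> {u0 - \<delta><..<u0 + \<delta>}"
    by force
  then show ?thesis
    using \<delta> by (intro exI[of _ \<delta>] conjI local_bound_swap[OF smooth_on_imp_continuous_on[OF S] U(1)])
      (auto intro!: borel_open open_Times)
qed

section \<open>From neighborhoods of points to compact sets\<close>

lemma local_bound_mono:
  assumes S: "continuous_on U S" and U: "open U" and B: "open B"
    and "local_bound S U p q w K B" "A \<subseteq> B"
  shows "local_bound S U p q w K A"
proof -
  obtain C where C: "C > 0" "\<forall>\<^sub>F j in sequentially. \<forall>\<epsilon>>0.
     emeasure lborel {z\<in>U. rescale p q j z \<in> B \<and> \<bar>S z\<bar> < \<epsilon>}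
       \<le> ennreal (C * (\<epsilon> * exp (w * real j)) powr (1 / real K) * exp (- (p + q) * real j))"
    using assms(4) unfolding local_bound_def by blast
  have "emeasure lborel {z\<in>U. rescale p q j z \<in> A \<and> \<bar>S z\<bar> < \<epsilon>}
      \<le> emeasure lborel {z\<in>U. rescale p q j z \<in> B \<and> \<bar>S z\<bar> < \<epsilon>}" for j \<epsilon>
    using sublevel_measurable[OF S U borel_open[OF B]] assms(5) by (intro emeasure_mono) auto
  then show ?thesis unfolding local_bound_def using C
    by (intro exI[of _ C]) (auto elim!: eventually_mono intro: order_trans)
qed

lemma local_bound_Un:
  assumes S: "continuous_on U S" and U: "open U" and AB: "open A" "open B"
    and "local_bound S U p q w K A" "local_bound S U p q w K B"
  shows "local_bound S U p q w K (A \<union> B)"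
proof -
  let ?M = "\<lambda>A j \<epsilon>. {z\<in>U. rescale p q j z \<in> A \<and> \<bar>S z\<bar> < \<epsilon>}"
  let ?f = "\<lambda>C j \<epsilon>. C * (\<epsilon> * exp (w * real j)) powr (1 / real K) * exp (- (p + q) * real j)"
  obtain C1 where C1: "C1 > 0" "\<forall>\<^sub>F j in sequentially. \<forall>\<epsilon>>0. emeasure lborel (?M A j \<epsilon>) \<le> ennreal (?f C1 j \<epsilon>)"
    using assms(5) unfolding local_bound_def by blast
  obtain C2 where C2: "C2 > 0" "\<forall>\<^sub>F j in sequentially. \<forall>\<epsilon>>0. emeasure lborel (?M B j \<epsilon>) \<le> ennreal (?f C2 j \<epsilon>)"
    using assms(6) unfolding local_bound_def by blast
  have "\<forall>\<^sub>F j in sequentially. \<forall>\<epsilon>>0. emeasure lborel (?M (A \<union> B) j \<epsilon>) \<le> ennreal (?f (C1 + C2) j \<epsilon>)"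
    using C1(2) C2(2)
  proof eventually_elim
    case (elim j)
    show ?case
    proof (intro allI impI)
      fix \<epsilon> :: real assume "\<epsilon> > 0"
      have "?M (A \<union> B) j \<epsilon> = ?M A j \<epsilon> \<union> ?M B j \<epsilon>" by auto
      then have "emeasure lborel (?M (A \<union> B) j \<epsilon>) \<le> emeasure lborel (?M A j \<epsilon>) + emeasure lborel (?M B j \<epsilon>)"
        using emeasure_subadditive[of "?M A j \<epsilon>" lborel "?M B j \<epsilon>"]
          sublevel_measurable[OF S U borel_open[OF AB(1)]] sublevel_measurable[OF S U borel_open[OF AB(2)]] by simp
      also have "\<dots> \<le> ennreal (?f C1 j \<epsilon>) + ennreal (?f C2 j \<epsilon>)"
        using elim \<open>\<epsilon> > 0\<close> by (intro add_mono) auto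
      also have "\<dots> = ennreal (?f (C1 + C2) j \<epsilon>)"
        using C1(1) C2(1) by (simp flip: ennreal_plus add: algebra_simps)
      finally show "emeasure lborel (?M (A \<union> B) j \<epsilon>) \<le> ennreal (?f (C1 + C2) j \<epsilon>)" .
    qed
  qed
  then show ?thesis unfolding local_bound_def using C1(1) C2(1) by (intro exI[of _ "C1 + C2"]) auto
qed

lemma local_bound_Union:
  assumes S: "continuous_on U S" and U: "open U" and "finite F"
    and "\<And>A. A \<in> F \<Longrightarrow> open A \<and> local_bound S U p q w K A"
  shows "local_bound S U p q w K (\<Union>F)"
  using assms(3,4)
proof (induction F)
  case empty
  show ?case unfolding local_bound_def by (intro exI[of _ 1]) auto
next
  case (insert A F)
  then show ?case by (auto intro!: local_bound_Un[OF S U])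
qed

text \<open>Finitely many neighborhoods suffice; their constants add up, and the largest of their
  starting scales serves for all.\<close>

lemma local_bound_compact:
  assumes S: "continuous_on U S" and U: "open U" and A: "compact A"
    and loc: "\<And>z. z \<in> A \<Longrightarrow> \<exists>B. open B \<and> z \<in> B \<and> local_bound S U p q w K B"
  shows "local_bound S U p q w K A"
proof -
  obtain B where B: "\<And>z. z \<in> A \<Longrightarrow> open (B z) \<and> z \<in> B z \<and> local_bound S U p q w K (B z)"
    using loc by metis
  obtain D where D: "D \<subseteq> A" "finite D" "A \<subseteq> (\<Union>z\<in>D. B z)"
    using compactE_image[OF A, of A B] B by blast
  have "local_bound S U p q w K (\<Union>(B ` D))"
    using D B by (intro local_bound_Union[OF S U]) auto
  moreover have "open (\<Union>(B ` D))" using D B by blast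
  ultimately show ?thesis using local_bound_mono[OF S U] D(3) by blast
qed

section \<open>Decomposition of a box into dilated annuli\<close>

text \<open>The unit box without its image under one dilation step. Removing an open box leaves a
  compact set that avoids the origin.\<close>

definition annulus :: "real \<Rightarrow> real \<Rightarrow> (real \<times> real) set" where
  "annulus p q = ({-1..1} \<times> {-1..1}) - ({- exp (- p)<..<exp (- p)} \<times> {- exp (- q)<..<exp (- q)})"

lemma compact_annulus: "compact (annulus p q)"
  unfolding annulus_def by (intro compact_diff compact_Times open_Times) auto

text \<open>Each induction step covers the central box at scale n by the annulus at that scale and
  the central box at scale n + 1.\<close>

lemma box_subset_annuli:
  assumes "J \<le> n"
  shows "{z\<in>U. rescale p q J z \<in> {-1..1} \<times> {-1..1} \<and> \<bar>S z\<bar> < \<epsilon>}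
    \<subseteq> {z. rescale p q n z \<in> {-1..1} \<times> {-1..1}} \<union>
      (\<Union>j\<in>{J..<n}. {z\<in>U. rescale p q j z \<in> annulus p q \<and> \<bar>S z\<bar> < \<epsilon>})"
  using assms
proof (induction n rule: dec_induct)
  case (step n)
  \<comment> \<open>The hole of the annulus at scale n lies in the unit box at scale n + 1,
    coordinate by coordinate.\<close>
  have in1: "exp (x * real (Suc n)) * t \<in> {-1..1}"
    if "exp (x * real n) * t \<in> {- exp (- x)<..<exp (- x)}" for x t :: real
  proof -
    have "\<bar>exp (x * real (Suc n)) * t\<bar> = exp x * \<bar>exp (x * real n) * t\<bar>"
      by (simp add: abs_mult exp_add algebra_simps)
    also have "\<dots> \<le> exp x * exp (- x)" using that by (intro mult_left_mono) auto
    finally show ?thesis by (simp add: abs_le_iff flip: exp_add)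
  qed
  have glue: "A \<subseteq> Q' \<union> (M \<union> B)" if "A \<subseteq> Q \<union> B" "Q \<subseteq> Q' \<union> R" "A \<subseteq> T" "R \<inter> T \<subseteq> M"
    for A B M Q Q' R T :: "(real \<times> real) set" using that by blast
  have "{J..<Suc n} = insert n {J..<n}" using step by auto
  then show ?case unfolding UN_insert
  proof (simp only: UN_insert, intro glue[OF step.IH, where T = "{z\<in>U. \<bar>S z\<bar> < \<epsilon>}"])
    show "{z. rescale p q n z \<in> {-1..1} \<times> {-1..1}} \<subseteq>
        {z. rescale p q (Suc n) z \<in> {-1..1} \<times> {-1..1}} \<union> {z. rescale p q n z \<in> annulus p q}"
      using in1 by (auto simp: rescale_def annulus_def simp del: of_nat_Suc)
  qed auto
qed auto

lemma emeasure_rescaled_box: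
  "emeasure lborel {z. rescale p q n z \<in> {-1..1} \<times> {-1..1}} \<le> ennreal (4 * exp (- (p + q) * real n))"
proof -
  let ?X = "exp (- p * real n)" and ?Y = "exp (- q * real n)"
  have XX: "exp (p * real n) * x = x / ?X" "exp (q * real n) * x = x / ?Y" for x
    by (simp_all add: exp_minus field_simps)
  have eq: "{z. rescale p q n z \<in> {-1..1} \<times> {-1..1}} = {-?X..?X} \<times> {-?Y..?Y}"
    unfolding rescale_def XX by (auto simp: field_simps)
  have "emeasure lborel ({-?X..?X} \<times> {-?Y..?Y}) \<le> ennreal (2 * ?Y * (?X - (- ?X)))"
  proof (rule emeasure_lborel_le_slices)
    show "{-?X..?X} \<times> {-?Y..?Y} \<in> sets borel" by (intro borel_closed closed_Times) auto
    fix x assume "x \<in> {-?X..?X}"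
    then have "Pair x -` ({-?X..?X} \<times> {-?Y..?Y}) = {-?Y..?Y}" by auto
    then show "emeasure lborel (Pair x -` ({-?X..?X} \<times> {-?Y..?Y})) \<le> ennreal (2 * ?Y)" by simp
  qed auto
  also have "2 * ?Y * (?X - (- ?X)) = 4 * exp (- (p + q) * real n)"
    by (simp add: algebra_simps flip: exp_add)
  finally show ?thesis unfolding eq .
qed

text \<open>The decomposition stops where \<open>exp (- w * real n)\<close> is about
  \<open>\<epsilon>\<close>: there the rescaled level has size one and the local bound is no better
  than the measure of the remaining box, which is the first summand. V is the box, cut to U, at the
  first scale J from which the local bound holds, hence independent of
  \<open>\<epsilon>\<close>.\<close>

lemma sublevel_emeasure_bound:
  assumes S: "continuous_on U S" and U: "open U" "(0, 0) \<in> U"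
    and lb: "local_bound S U p q w K (annulus p q)" and w: "w > 0"
  shows "\<exists>V. open V \<and> (0, 0) \<in> V \<and> V \<subseteq> U \<and> (\<exists>C>0. \<forall>\<^sub>F \<epsilon> in at_right 0.
     emeasure lborel {z\<in>V. \<bar>S z\<bar> < \<epsilon>} \<le> ennreal (4 * exp (- (p + q) * real (nat \<lfloor>- ln \<epsilon> / w\<rfloor>)) +
       C * \<epsilon> powr (1 / real K) * (\<Sum>j<nat \<lfloor>- ln \<epsilon> / w\<rfloor>. exp ((w / real K - (p + q)) * real j))))"
proof -
  obtain C where C: "C > 0" "\<forall>\<^sub>F j in sequentially. \<forall>\<epsilon>>0.
     emeasure lborel {z\<in>U. rescale p q j z \<in> annulus p q \<and> \<bar>S z\<bar> < \<epsilon>}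
       \<le> ennreal (C * (\<epsilon> * exp (w * real j)) powr (1 / real K) * exp (- (p + q) * real j))"
    using lb unfolding local_bound_def by blast
  then obtain J where J: "\<And>j \<epsilon>. j \<ge> J \<Longrightarrow> \<epsilon> > 0 \<Longrightarrow>
     emeasure lborel {z\<in>U. rescale p q j z \<in> annulus p q \<and> \<bar>S z\<bar> < \<epsilon>}
       \<le> ennreal (C * (\<epsilon> * exp (w * real j)) powr (1 / real K) * exp (- (p + q) * real j))"
    unfolding eventually_sequentially by blast
  define V where "V = U \<inter> rescale p q J -` ({-1<..<1} \<times> {-1<..<1})"
  have "open V" unfolding V_def
    using U(1) by (intro open_Int open_vimage open_Times)
      (auto simp: rescale_def intro!: continuous_intros)
  moreover have "(0, 0) \<in> V" using U(2) by (auto simp: V_def rescale_def)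
  moreover have "\<forall>\<^sub>F \<epsilon> in at_right 0.
     emeasure lborel {z\<in>V. \<bar>S z\<bar> < \<epsilon>} \<le> ennreal (4 * exp (- (p + q) * real (nat \<lfloor>- ln \<epsilon> / w\<rfloor>)) +
       C * \<epsilon> powr (1 / real K) * (\<Sum>j<nat \<lfloor>- ln \<epsilon> / w\<rfloor>. exp ((w / real K - (p + q)) * real j)))"
  proof -
    \<comment> \<open>This restriction guarantees \<open>J \<le> n\<close>.\<close>
    have "\<forall>\<^sub>F \<epsilon> in at_right (0::real). \<epsilon> < exp (- (w * real J))"
      by (rule order_tendstoD(2)[of "\<lambda>x. x" 0]) (auto intro: tendsto_ident_at)
    moreover have "\<forall>\<^sub>F \<epsilon> in at_right (0::real). \<epsilon> > 0" by (rule eventually_at_right_less)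
    ultimately show ?thesis
    proof eventually_elim
      case (elim \<epsilon>)
      define n where "n = nat \<lfloor>- ln \<epsilon> / w\<rfloor>"
      have "ln \<epsilon> < - (w * real J)" using elim by (metis exp_gt_zero ln_exp ln_less_cancel_iff)
      then have "real J \<le> - ln \<epsilon> / w" using w by (simp add: field_simps)
      then have Jn: "J \<le> n" unfolding n_def by (simp add: le_nat_floor)
      let ?M = "\<lambda>j. {z\<in>U. rescale p q j z \<in> annulus p q \<and> \<bar>S z\<bar> < \<epsilon>}"
      let ?Q = "{z. rescale p q n z \<in> {-1..1} \<times> {-1..1}}"
      have Mm: "?M j \<in> sets borel" for j
        by (rule sublevel_measurable[OF S U(1)]) (intro borel_compact compact_annulus)
      have Qm: "?Q \<in> sets borel"
      proof -
        have "closed (rescale p q n -` ({-1..1} \<times> {-1..1}))"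
          by (intro closed_vimage closed_Times) (auto simp: rescale_def intro!: continuous_intros)
        moreover have "rescale p q n -` ({-1..1} \<times> {-1..1}) = ?Q" by auto
        ultimately show ?thesis by (metis borel_closed)
      qed
      have Um: "(\<Union>j\<in>{J..<n}. ?M j) \<in> sets borel" using Mm by (intro sets.finite_UN) auto
      have "{z\<in>V. \<bar>S z\<bar> < \<epsilon>} \<subseteq> {z\<in>U. rescale p q J z \<in> {-1..1} \<times> {-1..1} \<and> \<bar>S z\<bar> < \<epsilon>}"
        by (auto simp: V_def mem_Times_iff)
      also have "\<dots> \<subseteq> ?Q \<union> (\<Union>j\<in>{J..<n}. ?M j)" by (rule box_subset_annuli[OF Jn])
      finally have "emeasure lborel {z\<in>V. \<bar>S z\<bar> < \<epsilon>} \<le> emeasure lborel (?Q \<union> (\<Union>j\<in>{J..<n}. ?M j))"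
        using Qm Um by (intro emeasure_mono) auto
      also have "\<dots> \<le> emeasure lborel ?Q + emeasure lborel (\<Union>j\<in>{J..<n}. ?M j)"
        using Qm Um by (intro emeasure_subadditive) auto
      also have "\<dots> \<le> emeasure lborel ?Q + (\<Sum>j\<in>{J..<n}. emeasure lborel (?M j))"
        using Mm by (intro add_left_mono emeasure_subadditive_finite) auto
      also have "\<dots> \<le> ennreal (4 * exp (- (p + q) * real n)) +
          (\<Sum>j\<in>{J..<n}. ennreal (C * (\<epsilon> * exp (w * real j)) powr (1 / real K) * exp (- (p + q) * real j)))"
        using elim by (intro add_mono emeasure_rescaled_box sum_mono J) auto
      also have "\<dots> = ennreal (4 * exp (- (p + q) * real n)) +
          (\<Sum>j\<in>{J..<n}. ennreal (C * \<epsilon> powr (1 / real K) * exp ((w / real K - (p + q)) * real j)))"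
      proof -
        have "(\<epsilon> * exp (w * real j)) powr (1 / real K) * exp (- (p + q) * real j)
            = \<epsilon> powr (1 / real K) * exp ((w / real K - (p + q)) * real j)" for j
          using elim by (simp add: powr_mult exp_powr_real algebra_simps flip: exp_add)
        then show ?thesis by (simp add: mult.assoc)
      qed
      \<comment> \<open>The missing terms with j < J are nonnegative; adding them makes the sum
        independent of J.\<close>
      also have "\<dots> \<le> ennreal (4 * exp (- (p + q) * real n)) +
          (\<Sum>j\<in>{..<n}. ennreal (C * \<epsilon> powr (1 / real K) * exp ((w / real K - (p + q)) * real j)))"
        by (intro add_left_mono sum_mono2) auto
      also have "\<dots> = ennreal (4 * exp (- (p + q) * real n) +
          C * \<epsilon> powr (1 / real K) * (\<Sum>j<n. exp ((w / real K - (p + q)) * real j)))"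
        using C(1) by (simp add: ennreal_plus sum_nonneg sum_distrib_left)
      finally show ?case unfolding n_def .
    qed
  qed
  ultimately show ?thesis using C(1) by (intro exI[of _ V]) (auto simp: V_def)
qed

subsection \<open>Summation over the scales\<close>

lemma scale_count_bounds:
  assumes "0 < \<epsilon>" "\<epsilon> < 1" "w > (0::real)"
  shows "real (nat \<lfloor>- ln \<epsilon> / w\<rfloor>) \<le> - ln \<epsilon> / w" "- ln \<epsilon> / w < real (nat \<lfloor>- ln \<epsilon> / w\<rfloor>) + 1"
proof -
  have "- ln \<epsilon> / w \<ge> 0" using assms by (intro divide_nonneg_pos) auto
  then show "real (nat \<lfloor>- ln \<epsilon> / w\<rfloor>) \<le> - ln \<epsilon> / w" "- ln \<epsilon> / w < real (nat \<lfloor>- ln \<epsilon> / w\<rfloor>) + 1"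
    by linarith+
qed

text \<open>Rounding down loses less than one scale, which costs the factor
  \<open>exp \<sigma>\<close>. Without rounding the value is \<open>\<epsilon>\<close> to the power
  \<open>\<sigma> / w\<close>, and this exponent is at least 1/d.\<close>

lemma exp_scale_count_le:
  fixes \<sigma> w d :: real
  assumes e: "0 < \<epsilon>" "\<epsilon> < 1" and w: "w > 0" "\<sigma> > 0" "d > 0" "w \<le> d * \<sigma>"
  shows "exp (- \<sigma> * real (nat \<lfloor>- ln \<epsilon> / w\<rfloor>)) \<le> exp \<sigma> * \<epsilon> powr (1 / d)"
proof -
  have "- \<sigma> * real (nat \<lfloor>- ln \<epsilon> / w\<rfloor>) \<le> \<sigma> + \<sigma> * (ln \<epsilon> / w)"
  proof -
    have "\<sigma> * (- ln \<epsilon> / w) \<le> \<sigma> * (real (nat \<lfloor>- ln \<epsilon> / w\<rfloor>) + 1)"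
      using scale_count_bounds(2)[OF e w(1)] w(2) by (intro mult_left_mono) auto
    then show ?thesis by (simp add: algebra_simps)
  qed
  also have "\<sigma> * (ln \<epsilon> / w) \<le> ln \<epsilon> / d"
  proof -
    have "1 / d \<le> \<sigma> / w" using w by (simp add: field_simps)
    then have "\<sigma> / w * ln \<epsilon> \<le> 1 / d * ln \<epsilon>"
      using e by (intro mult_right_mono_neg) auto
    then show ?thesis by simp
  qed
  finally have "exp (- \<sigma> * real (nat \<lfloor>- ln \<epsilon> / w\<rfloor>)) \<le> exp (\<sigma> + ln \<epsilon> / d)" by simp
  also have "\<dots> = exp \<sigma> * \<epsilon> powr (1 / d)" using e by (simp add: exp_add powr_def)
  finally show ?thesis .
qed

lemma scale_sum_lt:
  fixes \<sigma> w d :: real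
  assumes w: "w > 0" "\<sigma> > 0" "d > 0" "C > 0" and K: "real K = d" "w < d * \<sigma>"
  shows "\<exists>B>0. \<forall>\<epsilon>. 0 < \<epsilon> \<longrightarrow> \<epsilon> < 1 \<longrightarrow> 4 * exp (- \<sigma> * real (nat \<lfloor>- ln \<epsilon> / w\<rfloor>)) +
       C * \<epsilon> powr (1 / real K) * (\<Sum>j<nat \<lfloor>- ln \<epsilon> / w\<rfloor>. exp ((w / real K - \<sigma>) * real j)) \<le> B * \<epsilon> powr (1 / d)"
proof -
  define \<rho> where "\<rho> = exp (w / real K - \<sigma>)"
  have \<rho>: "0 < \<rho>" "\<rho> < 1" using w K by (auto simp: \<rho>_def field_simps)
  have sum: "(\<Sum>j<n. exp ((w / real K - \<sigma>) * real j)) \<le> 1 / (1 - \<rho>)" for n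
  proof -
    have "(\<Sum>j<n. exp ((w / real K - \<sigma>) * real j)) = (\<Sum>j<n. \<rho> ^ j)"
      by (simp add: \<rho>_def mult.commute flip: exp_of_nat_mult)
    also have "\<dots> = (1 - \<rho> ^ n) / (1 - \<rho>)" using \<rho> by (simp add: sum_gp_strict)
    also have "\<dots> \<le> 1 / (1 - \<rho>)" using \<rho> by (intro divide_right_mono) auto
    finally show ?thesis .
  qed
  show ?thesis
  proof (intro exI[of _ "4 * exp \<sigma> + C * (1 / (1 - \<rho>))"] conjI allI impI)
    show "0 < 4 * exp \<sigma> + C * (1 / (1 - \<rho>))" using w \<rho> by (intro add_pos_pos) auto
    fix \<epsilon> :: real assume e: "0 < \<epsilon>" "\<epsilon> < 1"
    have "C * \<epsilon> powr (1 / real K) * (\<Sum>j<nat \<lfloor>- ln \<epsilon> / w\<rfloor>. exp ((w / real K - \<sigma>) * real j))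
      \<le> C * \<epsilon> powr (1 / real K) * (1 / (1 - \<rho>))"
      using w sum by (intro mult_left_mono) auto
    with exp_scale_count_le[OF e w(1-3)] K
    show "4 * exp (- \<sigma> * real (nat \<lfloor>- ln \<epsilon> / w\<rfloor>)) +
       C * \<epsilon> powr (1 / real K) * (\<Sum>j<nat \<lfloor>- ln \<epsilon> / w\<rfloor>. exp ((w / real K - \<sigma>) * real j))
       \<le> (4 * exp \<sigma> + C * (1 / (1 - \<rho>))) * \<epsilon> powr (1 / d)"
      by (simp add: algebra_simps)
  qed
qed

text \<open>The exponents fit exactly: with \<open>\<mu> = w / real K - \<sigma>\<close> one has
  \<mu> / w = 1/K - 1/d, so the growth of the last term turns the prefactor \<epsilon>^(1/K) into
  \<epsilon>^(1/d).\<close>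

lemma scale_sum_gt:
  fixes \<sigma> w d :: real
  assumes w: "w > 0" "\<sigma> > 0" "d > 0" "C > 0" and K: "real K < d" "K \<ge> 1" "w = d * \<sigma>"
  shows "\<exists>B>0. \<forall>\<epsilon>. 0 < \<epsilon> \<longrightarrow> \<epsilon> < 1 \<longrightarrow> 4 * exp (- \<sigma> * real (nat \<lfloor>- ln \<epsilon> / w\<rfloor>)) +
       C * \<epsilon> powr (1 / real K) * (\<Sum>j<nat \<lfloor>- ln \<epsilon> / w\<rfloor>. exp ((w / real K - \<sigma>) * real j)) \<le> B * \<epsilon> powr (1 / d)"
proof -
  define \<mu> where "\<mu> = w / real K - \<sigma>"
  have "real K * \<sigma> < w" using K w by simp
  then have \<mu>: "\<mu> > 0" using K by (simp add: \<mu>_def field_simps)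
  have \<rho>: "exp \<mu> > 1" using \<mu> by simp
  have sum: "(\<Sum>j<n. exp (\<mu> * real j)) \<le> exp (\<mu> * real n) / (exp \<mu> - 1)" for n
  proof -
    have "(\<Sum>j<n. exp (\<mu> * real j)) = (\<Sum>j<n. exp \<mu> ^ j)"
      by (simp add: mult.commute flip: exp_of_nat_mult)
    also have "\<dots> = (exp \<mu> ^ n - 1) / (exp \<mu> - 1)" using \<rho> by (intro geometric_sum) auto
    also have "\<dots> \<le> exp \<mu> ^ n / (exp \<mu> - 1)" using \<rho> by (intro divide_right_mono) auto
    finally show ?thesis by (simp add: mult.commute flip: exp_of_nat_mult)
  qed
  show ?thesis unfolding \<mu>_def[symmetric]
  proof (intro exI[of _ "4 * exp \<sigma> + C / (exp \<mu> - 1)"] conjI allI impI)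
    show "0 < 4 * exp \<sigma> + C / (exp \<mu> - 1)" using w \<rho> by (intro add_pos_pos) auto
    fix \<epsilon> :: real assume e: "0 < \<epsilon>" "\<epsilon> < 1"
    let ?n = "nat \<lfloor>- ln \<epsilon> / w\<rfloor>"
    have P: "\<epsilon> powr (1 / real K) = exp (ln \<epsilon> / real K)" using e by (simp add: powr_def)
    have "\<mu> * real ?n \<le> \<mu> * (- ln \<epsilon> / w)"
      using scale_count_bounds(1)[OF e w(1)] \<mu> by (intro mult_left_mono) auto
    then have "exp (\<mu> * real ?n) / (exp \<mu> - 1) \<le> exp (\<mu> * (- ln \<epsilon> / w)) / (exp \<mu> - 1)"
      using \<rho> by (intro divide_right_mono) auto
    then have "C * \<epsilon> powr (1 / real K) * (\<Sum>j<?n. exp (\<mu> * real j))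
      \<le> C * \<epsilon> powr (1 / real K) * (exp (\<mu> * (- ln \<epsilon> / w)) / (exp \<mu> - 1))"
      using w order_trans[OF sum] by (intro mult_left_mono) auto
    also have "\<dots> = C / (exp \<mu> - 1) * exp (ln \<epsilon> / real K + \<mu> * (- ln \<epsilon> / w))"
      unfolding P exp_add by simp
    also have "ln \<epsilon> / real K + \<mu> * (- ln \<epsilon> / w) = ln \<epsilon> / d"
    proof -
      have "\<mu> / w = 1 / real K - 1 / d" using K w unfolding \<mu>_def by (simp add: field_simps)
      then have "\<mu> * (- ln \<epsilon> / w) = - ln \<epsilon> * (1 / real K - 1 / d)" by (metis mult.commute times_divide_eq_right)
      then show ?thesis by (simp add: algebra_simps)
    qed
    also have "exp (ln \<epsilon> / d) = \<epsilon> powr (1 / d)" using e by (simp add: powr_def)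
    finally show "4 * exp (- \<sigma> * real ?n) + C * \<epsilon> powr (1 / real K) * (\<Sum>j<?n. exp (\<mu> * real j))
       \<le> (4 * exp \<sigma> + C / (exp \<mu> - 1)) * \<epsilon> powr (1 / d)"
      using exp_scale_count_le[OF e w(1-3)] K unfolding distrib_right by linarith
  qed
qed

text \<open>All terms equal 1, and their number is at most |ln \<epsilon>| / w. For
  \<open>\<epsilon> < exp (-1)\<close> the logarithm has modulus at least 1, so it also absorbs the
  contribution of the central box.\<close>

lemma scale_sum_eq:
  fixes \<sigma> w d :: real
  assumes w: "w > 0" "\<sigma> > 0" "d > 0" "C > 0" and K: "real K = d" "w = d * \<sigma>"
  shows "\<exists>B>0. \<forall>\<epsilon>. 0 < \<epsilon> \<longrightarrow> \<epsilon> < exp (-1) \<longrightarrow> 4 * exp (- \<sigma> * real (nat \<lfloor>- ln \<epsilon> / w\<rfloor>)) +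
       C * \<epsilon> powr (1 / real K) * (\<Sum>j<nat \<lfloor>- ln \<epsilon> / w\<rfloor>. exp ((w / real K - \<sigma>) * real j))
       \<le> B * \<bar>ln \<epsilon>\<bar> * \<epsilon> powr (1 / d)"
proof (intro exI[of _ "4 * exp \<sigma> + C / w"] conjI allI impI)
  show "0 < 4 * exp \<sigma> + C / w" using w by (intro add_pos_pos) auto
  fix \<epsilon> :: real assume e: "0 < \<epsilon>" "\<epsilon> < exp (-1)"
  let ?n = "nat \<lfloor>- ln \<epsilon> / w\<rfloor>"
  have ln: "ln \<epsilon> < -1" using e by (metis exp_gt_zero ln_exp ln_less_cancel_iff)
  then have abs1: "1 \<le> \<bar>ln \<epsilon>\<bar>" by linarith
  have e1: "\<epsilon> < 1" using e(2) by (rule less_trans) simp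
  have 0: "w / d - \<sigma> = 0" using K(2) w by simp
  have "4 * exp (- \<sigma> * real ?n) \<le> 4 * (exp \<sigma> * \<epsilon> powr (1 / d))"
    using exp_scale_count_le[OF e(1) e1 w(1-3)] K by simp
  also have "\<dots> = 4 * (exp \<sigma> * \<epsilon> powr (1 / d)) * 1" by (rule mult_1_right[symmetric])
  also have "\<dots> \<le> 4 * (exp \<sigma> * \<epsilon> powr (1 / d)) * \<bar>ln \<epsilon>\<bar>"
    using abs1 by (rule mult_left_mono) simp
  finally have 1: "4 * exp (- \<sigma> * real ?n) \<le> 4 * (exp \<sigma> * \<epsilon> powr (1 / d)) * \<bar>ln \<epsilon>\<bar>" .
  have "real ?n \<le> \<bar>ln \<epsilon>\<bar> / w" using scale_count_bounds(1)[OF e(1) e1 w(1)] ln by simp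
  then have "C * \<epsilon> powr (1 / d) * real ?n \<le> C * \<epsilon> powr (1 / d) * (\<bar>ln \<epsilon>\<bar> / w)"
    using w by (intro mult_left_mono) auto
  with 1 show "4 * exp (- \<sigma> * real ?n) + C * \<epsilon> powr (1 / real K) * (\<Sum>j<?n. exp ((w / real K - \<sigma>) * real j))
       \<le> (4 * exp \<sigma> + C / w) * \<bar>ln \<epsilon>\<bar> * \<epsilon> powr (1 / d)"
    unfolding K(1) 0 by (simp add: algebra_simps)
qed

subsection \<open>The Newton polygon\<close>

lemma convex_newton_polygon: "convex (newton_polygon S)"
  unfolding newton_polygon_def by (rule convex_convex_hull)

lemma newton_polygon_quadrant:
  "taylor_coeff S a b \<noteq> 0 \<Longrightarrow> real a \<le> t1 \<Longrightarrow> real b \<le> t2 \<Longrightarrow> (t1, t2) \<in> newton_polygon S"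
  unfolding newton_polygon_def by (rule hull_inc) auto

lemma newton_polygon_subset:
  assumes "convex C" "\<And>a b t1 t2. taylor_coeff S a b \<noteq> 0 \<Longrightarrow> real a \<le> t1 \<Longrightarrow> real b \<le> t2 \<Longrightarrow> (t1, t2) \<in> C"
  shows "newton_polygon S \<subseteq> C"
  unfolding newton_polygon_def using assms by (intro hull_minimal) auto

text \<open>The preimage of the polygon under translation by a nonnegative vector is convex and
  contains every generating quadrant, so minimality of the hull applies.\<close>

lemma newton_polygon_upward:
  assumes "(t1, t2) \<in> newton_polygon S" "t1 \<le> s1" "t2 \<le> s2"
  shows "(s1, s2) \<in> newton_polygon S"
proof -
  let ?N = "newton_polygon S"
  have "convex ((\<lambda>z. z + h) -` ?N)" for h
    using convex_translation[OF convex_newton_polygon, of "-h"] by (auto simp: image_def vimage_def algebra_simps)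
  then have "?N \<subseteq> (\<lambda>z. z + (s1 - t1, s2 - t2)) -` ?N"
    using assms(2,3) by (intro newton_polygon_subset) (auto intro!: newton_polygon_quadrant)
  then show ?thesis using assms(1) by fastforce
qed

lemma newton_polygon_nonneg: "z \<in> newton_polygon S \<Longrightarrow> 0 \<le> fst z \<and> 0 \<le> snd z"
proof -
  have "newton_polygon S \<subseteq> {0..} \<times> {0..}"
    by (intro newton_polygon_subset convex_Times) (auto intro: order_trans[OF of_nat_0_le_iff])
  then show "z \<in> newton_polygon S \<Longrightarrow> 0 \<le> fst z \<and> 0 \<le> snd z" by force
qed

text \<open>Lets \<open>hull_minimal\<close> determine the face of the Newton polygon on a supporting line.\<close>

lemma convex_lex_halfspace:
  fixes p q w :: real
  assumes "convex C"
  shows "convex ({z. w < p * fst z + q * snd z} \<union> ({z. p * fst z + q * snd z = w} \<inter> C))"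
proof (rule convexI)
  fix x y :: "real \<times> real" and u v :: real
  let ?l = "\<lambda>z. p * fst z + q * snd z"
  let ?X = "{z. w < ?l z} \<union> ({z. ?l z = w} \<inter> C)"
  assume xy: "x \<in> ?X" "y \<in> ?X" and uv: "0 \<le> u" "0 \<le> v" "u + v = 1"
  have l: "?l (u *\<^sub>R x + v *\<^sub>R y) = u * ?l x + v * ?l y" by (simp add: algebra_simps)
  have w: "w = u * w + v * w" using uv by (metis distrib_right mult_1)
  have ge: "w \<le> ?l x" "w \<le> ?l y" using xy by auto
  consider "u = 0" | "v = 0" | "u > 0" "v > 0" "?l x = w" "?l y = w" | "u > 0" "v > 0" "w < ?l x \<or> w < ?l y"
    using ge uv by linarith
  then show "u *\<^sub>R x + v *\<^sub>R y \<in> ?X"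
  proof cases
    case 3
    then have "u *\<^sub>R x + v *\<^sub>R y \<in> C" using xy uv assms by (intro convexD) auto
    moreover have "?l (u *\<^sub>R x + v *\<^sub>R y) = w" using 3 w l by simp
    ultimately show ?thesis by simp
  next
    case 4
    have "u * w \<le> u * ?l x" "v * w \<le> v * ?l y" using 4 ge by (auto intro: mult_left_mono)
    moreover have "u * w < u * ?l x \<or> v * w < v * ?l y" using 4 by auto
    ultimately have "w < ?l (u *\<^sub>R x + v *\<^sub>R y)" using w l by linarith
    then show ?thesis by simp
  qed (use xy uv in auto)
qed

text \<open>With both weights positive a quadrant touches the line at most in its corner, so lattice
  points alone determine the face. C is left general because it is used both as their convex hull
  and as a half-plane.\<close>

lemma newton_polygon_supporting_face_subset:
  assumes pq: "p > 0" "q > 0"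
    and supp: "\<And>a b. taylor_coeff S a b \<noteq> 0 \<Longrightarrow> w \<le> p * real a + q * real b"
    and C: "convex C" "\<And>a b. taylor_coeff S a b \<noteq> 0 \<Longrightarrow> p * real a + q * real b = w \<Longrightarrow> (real a, real b) \<in> C"
  shows "newton_polygon S \<inter> {z. p * fst z + q * snd z = w} \<subseteq> C"
proof -
  have "newton_polygon S \<subseteq> {z. w < p * fst z + q * snd z} \<union> ({z. p * fst z + q * snd z = w} \<inter> C)"
  proof (rule newton_polygon_subset[OF convex_lex_halfspace[OF C(1)]])
    fix a b t1 t2 assume t: "taylor_coeff S a b \<noteq> 0" "real a \<le> t1" "real b \<le> t2"
    have le: "p * real a \<le> p * t1" "q * real b \<le> q * t2" using t pq by auto
    show "(t1, t2) \<in> {z. w < p * fst z + q * snd z} \<union> ({z. p * fst z + q * snd z = w} \<inter> C)"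
    proof (cases "w < p * t1 + q * t2")
      case False
      then have "p * t1 = p * real a" "q * t2 = q * real b" "p * real a + q * real b = w"
        using supp[OF t(1)] le by linarith+
      then show ?thesis using C(2)[OF t(1)] pq by auto
    qed simp
  qed
  then show ?thesis by auto
qed

text \<open>On a horizontal supporting line the quadrants leave rays, so the corners alone do not
  span the face; what survives is a corner weakly to the left of each of its points.\<close>

lemma newton_polygon_bottom:
  assumes "\<And>a b. taylor_coeff S a b \<noteq> 0 \<Longrightarrow> m \<le> real b" "(t, m) \<in> newton_polygon S"
  shows "\<exists>a b. taylor_coeff S a b \<noteq> 0 \<and> real b = m \<and> real a \<le> t"
proof (rule ccontr)
  assume contra: "\<not> ?thesis"
  have "newton_polygon S \<subseteq> {z. m < 0 * fst z + 1 * snd z} \<union> ({z. 0 * fst z + 1 * snd z = m} \<inter> ({t<..} \<times> UNIV))"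
  proof (rule newton_polygon_subset[OF convex_lex_halfspace], rule convex_Times)
    fix a b t1 t2 assume t: "taylor_coeff S a b \<noteq> 0" "real a \<le> t1" "real b \<le> t2"
    then show "(t1, t2) \<in> {z. m < 0 * fst z + 1 * snd z} \<union> ({z. 0 * fst z + 1 * snd z = m} \<inter> ({t<..} \<times> UNIV))"
      using assms(1)[OF t(1)] contra by force
  qed auto
  then show False using assms(2) by auto
qed

lemma newton_polygon_left:
  assumes "\<And>a b. taylor_coeff S a b \<noteq> 0 \<Longrightarrow> m \<le> real a" "(m, t) \<in> newton_polygon S"
  shows "\<exists>a b. taylor_coeff S a b \<noteq> 0 \<and> real a = m \<and> real b \<le> t"
proof (rule ccontr)
  assume contra: "\<not> ?thesis"
  have "newton_polygon S \<subseteq> {z. m < 1 * fst z + 0 * snd z} \<union> ({z. 1 * fst z + 0 * snd z = m} \<inter> (UNIV \<times> {t<..}))"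
  proof (rule newton_polygon_subset[OF convex_lex_halfspace], rule convex_Times)
    fix a b t1 t2 assume t: "taylor_coeff S a b \<noteq> 0" "real a \<le> t1" "real b \<le> t2"
    then show "(t1, t2) \<in> {z. m < 1 * fst z + 0 * snd z} \<union> ({z. 1 * fst z + 0 * snd z = m} \<inter> (UNIV \<times> {t<..}))"
      using assms(1)[OF t(1)] contra by force
  qed auto
  then show False using assms(2) by auto
qed

section \<open>Supporting lines and faces of the Newton polygon\<close>

lemma aff_dim_newton_polygon:
  assumes "taylor_coeff S a b \<noteq> 0"
  shows "aff_dim (newton_polygon S) = 2"
proof -
  have "open ({real a<..} \<times> {real b<..})" by (intro open_Times open_greaterThan)
  moreover have "{real a<..} \<times> {real b<..} \<subseteq> newton_polygon S"
    using newton_polygon_quadrant[OF assms] by auto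
  ultimately have "{real a<..} \<times> {real b<..} \<subseteq> interior (newton_polygon S)"
    by (intro interior_maximal)
  moreover have "(real a + 1, real b + 1) \<in> {real a<..} \<times> {real b<..}" by simp
  ultimately have "interior (newton_polygon S) \<noteq> {}" by blast
  then show ?thesis by (simp add: aff_dim_nonempty_interior)
qed

text \<open>The normal vector has nonnegative entries because the polygon is closed under moving
  right and up.\<close>

lemma newton_polygon_supporting_line:
  assumes x: "(x1, x2) \<in> newton_polygon S" "(x1, x2) \<notin> rel_interior (newton_polygon S)"
  obtains \<alpha> \<beta> where "\<alpha> \<ge> 0" "\<beta> \<ge> 0" "(\<alpha>, \<beta>) \<noteq> (0::real, 0::real)"
    "\<And>z. z \<in> newton_polygon S \<Longrightarrow> \<alpha> * x1 + \<beta> * x2 \<le> \<alpha> * fst z + \<beta> * snd z"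
proof -
  obtain v where v: "v \<noteq> 0" "\<And>y. y \<in> newton_polygon S \<Longrightarrow> v \<bullet> (x1, x2) \<le> v \<bullet> y"
    using supporting_hyperplane_rel_boundary[OF convex_newton_polygon x] by metis
  obtain \<alpha> \<beta> where ab: "v = (\<alpha>, \<beta>)" by (cases v)
  have le: "\<alpha> * x1 + \<beta> * x2 \<le> \<alpha> * fst z + \<beta> * snd z" if "z \<in> newton_polygon S" for z
    using v(2)[OF that] by (simp add: ab inner_prod_def)
  have "(x1 + 1, x2) \<in> newton_polygon S" "(x1, x2 + 1) \<in> newton_polygon S"
    by (rule newton_polygon_upward[OF x(1)]; simp)+
  from le[OF this(1)] le[OF this(2)] have "\<alpha> \<ge> 0" "\<beta> \<ge> 0" by (simp_all add: algebra_simps)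
  then show ?thesis using that v(1) le by (auto simp: ab zero_prod_def)
qed

lemma newton_polygon_line_face:
  assumes "\<And>z. z \<in> newton_polygon S \<Longrightarrow> w \<le> p * fst z + q * snd z" "(p, q) \<noteq> (0, 0)"
  shows "newton_polygon S \<inter> {z. p * fst z + q * snd z = w} face_of newton_polygon S"
    and "aff_dim (newton_polygon S \<inter> {z. p * fst z + q * snd z = w}) \<le> 1"
proof -
  have eq: "{z. p * fst z + q * snd z = w} = {z. (p, q) \<bullet> z = w}" by (simp add: inner_prod_def)
  show "newton_polygon S \<inter> {z. p * fst z + q * snd z = w} face_of newton_polygon S"
    unfolding eq using assms(1)
    by (intro face_of_Int_supporting_hyperplane_ge convex_newton_polygon) (simp add: inner_prod_def)
  have "aff_dim (newton_polygon S \<inter> {z. (p, q) \<bullet> z = w}) \<le> aff_dim {z. (p, q) \<bullet> z = w}"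
    by (rule aff_dim_subset) auto
  also have "\<dots> = 1" using assms(2) by (subst aff_dim_hyperplane) (auto simp: zero_prod_def)
  finally show "aff_dim (newton_polygon S \<inter> {z. p * fst z + q * snd z = w}) \<le> 1" unfolding eq .
qed

text \<open>A face that meets the relative interior of e contains e, so a supporting line at (d, d)
  carries the whole edge. The face on that line cannot be larger, since a proper face of it would
  have smaller dimension.\<close>

lemma newton_polygon_edge_line:
  assumes e: "e edge_of newton_polygon S" and x: "(d, d) \<in> rel_interior e"
    and nz: "taylor_coeff S a0 b0 \<noteq> 0"
  obtains \<alpha> \<beta> where "\<alpha> \<ge> 0" "\<beta> \<ge> 0" "(\<alpha>, \<beta>) \<noteq> (0::real, 0::real)"
    "\<And>z. z \<in> newton_polygon S \<Longrightarrow> \<alpha> * d + \<beta> * d \<le> \<alpha> * fst z + \<beta> * snd z"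
    "e = newton_polygon S \<inter> {z. \<alpha> * fst z + \<beta> * snd z = \<alpha> * d + \<beta> * d}"
proof -
  let ?N = "newton_polygon S"
  have face: "e face_of ?N" and dim: "aff_dim e = 1" using e by (auto simp: edge_of_def)
  have xe: "(d, d) \<in> e" using x rel_interior_subset by blast
  have "e \<noteq> ?N" using dim aff_dim_newton_polygon[OF nz] by auto
  then have "(d, d) \<in> ?N" "(d, d) \<notin> rel_interior ?N"
    using face_of_disjoint_rel_interior[OF face] face_of_imp_subset[OF face] xe by auto
  then obtain \<alpha> \<beta> where ab: "\<alpha> \<ge> 0" "\<beta> \<ge> 0" "(\<alpha>, \<beta>) \<noteq> (0::real, 0::real)"
    "\<And>z. z \<in> ?N \<Longrightarrow> \<alpha> * d + \<beta> * d \<le> \<alpha> * fst z + \<beta> * snd z"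
    using newton_polygon_supporting_line by metis
  let ?F = "?N \<inter> {z. \<alpha> * fst z + \<beta> * snd z = \<alpha> * d + \<beta> * d}"
  have F: "?F face_of ?N" "aff_dim ?F \<le> 1"
    using newton_polygon_line_face[OF ab(4,3)] by auto
  have "e \<subseteq> ?F"
  proof (rule subset_of_face_of[OF F(1) face_of_imp_subset[OF face]])
    show "?F \<inter> rel_interior e \<noteq> {}" using x \<open>(d, d) \<in> ?N\<close> by auto
  qed
  then have "e face_of ?F" using face F(1) by (meson face_of_face)
  then have eF: "e = ?F"
    using face_of_aff_dim_lt[of ?F e] face_of_imp_convex[OF F(1)] F(2) dim by fastforce
  show ?thesis by (rule that[OF ab(1-3) _ eF]) (rule ab(4))
qed

text \<open>The segment from y to x can be prolonged beyond x inside e, and g changes along it at a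
  constant nonzero rate, so it falls below \<open>g x\<close> at one of the two ends.\<close>

lemma rel_interior_beyond:
  fixes x y :: "real \<times> real" and g :: "real \<times> real \<Rightarrow> real"
  assumes "convex e" "x \<in> rel_interior e" "y \<in> e" "linear g" "g y \<noteq> g x"
  shows "\<exists>z\<in>e. g z < g x"
proof (cases "g y < g x")
  case False
  obtain m where m: "m > 1" "(1 - m) *\<^sub>R y + m *\<^sub>R x \<in> e"
    using convex_rel_interior_if2[OF assms(1,2)] hull_inc[OF assms(3)] by blast
  have "g ((1 - m) *\<^sub>R y + m *\<^sub>R x) = g x - (m - 1) * (g y - g x)"
    unfolding linear_add[OF assms(4)] linear_scale[OF assms(4)] by (simp add: algebra_simps)
  also have "\<dots> < g x" using False m(1) assms(5) by (simp add: zero_less_mult_iff)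
  finally show ?thesis using m(2) by blast
qed (use assms in auto)

lemma edge_has_other_point:
  fixes x :: "real \<times> real"
  assumes "aff_dim e = 1" shows "\<exists>y\<in>e. y \<noteq> x"
proof (rule ccontr)
  assume "\<not> ?thesis"
  then have "aff_dim e \<le> aff_dim {x}" by (intro aff_dim_subset) auto
  then show False using assms by simp
qed

subsection \<open>Weights adapted to the phase\<close>

text \<open>The clauses match the points of the annulus: a monomial with \<open>b \<le> K\<close>
  handles v = 0, one with \<open>a \<le> K\<close> handles u = 0, and every other point is moved to
  first coordinate 1 or -1 by quasi-homogeneity. N ranges over all truncations beyond the line,
  among which the limit does not change.\<close>

definition admissible_weights :: "(real \<times> real \<Rightarrow> real) \<Rightarrow> real \<Rightarrow> real \<Rightarrow> real \<Rightarrow> nat \<Rightarrow> bool" where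
  "admissible_weights S p q w K \<longleftrightarrow> p > 0 \<and> q > 0 \<and> w > 0 \<and> K \<ge> 1 \<and>
     (\<forall>a b. taylor_coeff S a b \<noteq> 0 \<longrightarrow> w \<le> p * real a + q * real b) \<and>
     (\<exists>a b. taylor_coeff S a b \<noteq> 0 \<and> p * real a + q * real b = w \<and> a \<le> K) \<and>
     (\<exists>a b. taylor_coeff S a b \<noteq> 0 \<and> p * real a + q * real b = w \<and> b \<le> K) \<and>
     (\<forall>N c r. w < p * real N \<longrightarrow> w < q * real N \<longrightarrow> c \<in> {1, -1} \<longrightarrow> r \<noteq> 0 \<longrightarrow>
        (\<exists>k\<le>K. scaled_deriv_limit S p q w N k c r \<noteq> 0))"

lemma line_index_less:
  assumes "p > 0" "q > 0" "w < p * real N" "w < q * real N" "p * real a + q * real b = w"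
  shows "a < N" "b < N"
proof -
  have "0 \<le> p * real a" "0 \<le> q * real b" using assms(1,2) by simp_all
  then have "p * real a < p * real N" "q * real b < q * real N" using assms by linarith+
  then show "a < N" "b < N" using assms by simp_all
qed

lemma scaled_deriv_limit_0_single:
  assumes pq: "p > 0" "q > 0" "w < p * real N" "w < q * real N"
    and line: "p * real a0 + q * real b0 = w"
    and only: "\<And>a b. taylor_coeff S a b \<noteq> 0 \<Longrightarrow> p * real a + q * real b = w \<Longrightarrow> a = a0 \<and> b = b0"
  shows "scaled_deriv_limit S p q w N 0 u v = taylor_coeff S a0 b0 * u ^ a0 * v ^ b0"
proof -
  have "a0 < N" "b0 < N" using line_index_less[OF pq line] by auto
  have "(if p * real a + q * real (b + 0) = w then taylor_coeff ((partial_y ^^ 0) S) a b * u ^ a * v ^ b else 0)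
      = (if a = a0 then if b = b0 then taylor_coeff S a b * u ^ a * v ^ b else 0 else 0)" for a b
  proof (cases "a = a0 \<and> b = b0")
    case True
    then show ?thesis using line by simp
  next
    case False
    then have "taylor_coeff S a b = 0 \<or> p * real a + q * real b \<noteq> w" using only by blast
    then show ?thesis using False by auto
  qed
  then have "scaled_deriv_limit S p q w N 0 u v =
    (\<Sum>b<N. \<Sum>a<N. if a = a0 then if b = b0 then taylor_coeff S a b * u ^ a * v ^ b else 0 else 0)"
    unfolding scaled_deriv_limit_def by simp
  also have "\<dots> = taylor_coeff S a0 b0 * u ^ a0 * v ^ b0"
    using \<open>a0 < N\<close> \<open>b0 < N\<close> by (simp add: sum.delta)
  finally show ?thesis .
qed

lemma taylor_coeff_00: "taylor_coeff S 0 0 = S (0, 0)"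
  by (simp add: taylor_coeff_def)

lemma line_value_pos:
  assumes "S (0, 0) = 0" "p > 0" "q > 0" "taylor_coeff S a b \<noteq> 0" "p * real a + q * real b = w"
  shows "w > 0"
proof -
  have "a > 0 \<or> b > 0" using assms(1,4) taylor_coeff_00[of S] by (metis gr0I)
  then have "p * real a > 0 \<or> q * real b > 0" using assms(2,3) by (auto simp: zero_less_mult_iff)
  moreover have "p * real a \<ge> 0" "q * real b \<ge> 0" using assms(2,3) by simp_all
  ultimately show ?thesis using assms by linarith
qed

text \<open>A single monomial has no zeros off the axes, so k = 0 works there, and K has to dominate
  the exponents only for the sake of the axes.\<close>

lemma admissible_weights_vertex:
  assumes S0: "S (0, 0) = 0" and pq: "p > 0" "q > 0" and K: "K \<ge> 1" "a0 \<le> K" "b0 \<le> K"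
    and nz: "taylor_coeff S a0 b0 \<noteq> 0" and line: "p * real a0 + q * real b0 = w"
    and only: "\<And>a b. taylor_coeff S a b \<noteq> 0 \<Longrightarrow> (a, b) \<noteq> (a0, b0) \<Longrightarrow> w < p * real a + q * real b"
  shows "admissible_weights S p q w K"
  unfolding admissible_weights_def
proof (intro conjI allI impI)
  show "w > 0" by (rule line_value_pos[OF S0 pq nz line])
  show "w \<le> p * real a + q * real b" if "taylor_coeff S a b \<noteq> 0" for a b
    using only[OF that] line by (cases "(a, b) = (a0, b0)") auto
  fix N :: nat and c r :: real
  assume N: "w < p * real N" "w < q * real N" and c: "c \<in> {1, -1}" "r \<noteq> 0"
  have "scaled_deriv_limit S p q w N 0 c r = taylor_coeff S a0 b0 * c ^ a0 * r ^ b0"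
    using only by (intro scaled_deriv_limit_0_single[OF pq N line]) force
  then show "\<exists>k\<le>K. scaled_deriv_limit S p q w N k c r \<noteq> 0" using nz c by (intro exI[of _ 0]) auto
qed (use assms in blast)+

text \<open>The weight \<open>real a0 + 1\<close> is chosen against the next row: for b >= b0 + 1
  the value is at least (a0 + 1)(b0 + 1), which exceeds the value at the vertex by 1.\<close>

lemma admissible_weights_bottom_vertex:
  assumes S0: "S (0, 0) = 0" and K: "b0 \<ge> 1" "a0 \<le> b0"
    and nz: "taylor_coeff S a0 b0 \<noteq> 0"
    and low: "\<And>a b. taylor_coeff S a b \<noteq> 0 \<Longrightarrow> b0 \<le> b"
    and left: "\<And>a. taylor_coeff S a b0 \<noteq> 0 \<Longrightarrow> a0 \<le> a"
  shows "admissible_weights S 1 (real a0 + 1) (real a0 + (real a0 + 1) * real b0) b0"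
proof (rule admissible_weights_vertex[OF S0 _ _ K(1) K(2) _ nz])
  fix a b assume ab: "taylor_coeff S a b \<noteq> 0" "(a, b) \<noteq> (a0, b0)"
  show "real a0 + (real a0 + 1) * real b0 < 1 * real a + (real a0 + 1) * real b"
  proof (cases "b = b0")
    case True
    then show ?thesis using left ab by force
  next
    case False
    then have "real b0 + 1 \<le> real b" using low[OF ab(1)] by linarith
    then have "(real a0 + 1) * (real b0 + 1) \<le> (real a0 + 1) * real b" by (intro mult_left_mono) auto
    moreover have "(real a0 + 1) * (real b0 + 1) = (real a0 + 1) * real b0 + real a0 + 1" by (simp add: algebra_simps)
    ultimately show ?thesis using of_nat_0_le_iff[of a, where ?'a = real] by linarith
  qed
qed auto

lemma admissible_weights_left_vertex:
  assumes S0: "S (0, 0) = 0" and K: "a0 \<ge> 1" "b0 \<le> a0"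
    and nz: "taylor_coeff S a0 b0 \<noteq> 0"
    and low: "\<And>a b. taylor_coeff S a b \<noteq> 0 \<Longrightarrow> a0 \<le> a"
    and bot: "\<And>b. taylor_coeff S a0 b \<noteq> 0 \<Longrightarrow> b0 \<le> b"
  shows "admissible_weights S (real b0 + 1) 1 (real b0 + (real b0 + 1) * real a0) a0"
proof (rule admissible_weights_vertex[OF S0 _ _ K(1) _ K(2) nz])
  fix a b assume ab: "taylor_coeff S a b \<noteq> 0" "(a, b) \<noteq> (a0, b0)"
  show "real b0 + (real b0 + 1) * real a0 < (real b0 + 1) * real a + 1 * real b"
  proof (cases "a = a0")
    case True
    then show ?thesis using bot ab by force
  next
    case False
    then have "real a0 + 1 \<le> real a" using low[OF ab(1)] by linarith
    then have "(real b0 + 1) * (real a0 + 1) \<le> (real b0 + 1) * real a" by (intro mult_left_mono) auto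
    moreover have "(real b0 + 1) * (real a0 + 1) = (real b0 + 1) * real a0 + real b0 + 1" by (simp add: algebra_simps)
    ultimately show ?thesis using of_nat_0_le_iff[of b, where ?'a = real] by linarith
  qed
qed auto

section \<open>Edge polynomials and orders of their roots\<close>

text \<open>Differentiation lowers the order of a root by exactly one, so the value at r becomes
  nonzero after as many steps as the order.\<close>

lemma higher_pderiv_nonzero_at_order:
  fixes Q :: "real poly"
  assumes "Q \<noteq> 0" shows "\<exists>k\<le>order r Q. poly ((pderiv ^^ k) Q) r \<noteq> 0"
  using assms
proof (induction "order r Q" arbitrary: Q)
  case 0
  then show ?case using order_root[of Q r] by auto
next
  case (Suc n)
  then have root: "poly Q r = 0" using order_root[of Q r] by auto
  have ord: "order r (pderiv Q) = n" using order_pderiv[OF Suc.prems root] Suc.hyps(2) by simp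
  have "pderiv Q \<noteq> 0"
  proof
    assume "pderiv Q = 0"
    then have "degree Q = 0" using pderiv_eq_0_iff by blast
    then show False using root Suc.prems poly_zero by blast
  qed
  then obtain k where "k \<le> n" "poly ((pderiv ^^ k) (pderiv Q)) r \<noteq> 0"
    using Suc.hyps(1)[of "pderiv Q"] ord by auto
  then show ?case using Suc.hyps(2) by (intro exI[of _ "Suc k"]) (auto simp: funpow_swap1)
qed

lemma poly_eq_sum_coeff:
  fixes Q :: "real poly"
  assumes "\<And>i. i \<ge> N \<Longrightarrow> coeff Q i = 0"
  shows "poly Q r = (\<Sum>i<N. coeff Q i * r ^ i)"
proof -
  have "poly Q r = (\<Sum>i\<in>{..degree Q} \<union> {..<N}. coeff Q i * r ^ i)"
    unfolding poly_altdef by (intro sum.mono_neutral_left) (auto simp: coeff_eq_0)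
  also have "\<dots> = (\<Sum>i<N. coeff Q i * r ^ i)"
    using assms by (intro sum.mono_neutral_right) auto
  finally show ?thesis .
qed

lemma coeff_edge_poly:
  assumes pq: "p > 0" "q > 0" "w < p * real N" "w < q * real N"
    and e: "e \<subseteq> {z. p * fst z + q * snd z = w}"
      "\<And>a b. taylor_coeff S a b \<noteq> 0 \<Longrightarrow> p * real a + q * real b = w \<Longrightarrow> (real a, real b) \<in> e"
  shows "coeff (edge_poly S e c) b =
    (\<Sum>a<N. if p * real a + q * real b = w then taylor_coeff S a b * c ^ a else 0)"
proof -
  \<comment> \<open>The range of the second exponent is enlarged by \<open>Suc b\<close> so that it
    contains b even when \<open>b \<ge> N\<close>.\<close>
  let ?I = "{(a, b). (real a, real b) \<in> e}" and ?B = "{..<N} \<times> {..<N + Suc b}"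
  have sub: "?I \<subseteq> ?B" using e(1) line_index_less[OF pq] by fastforce
  have "coeff (edge_poly S e c) b = (\<Sum>(a, i)\<in>?I. if i = b then taylor_coeff S a i * c ^ a else 0)"
    unfolding edge_poly_def coeff_sum by (intro sum.cong) auto
  also have "\<dots> = (\<Sum>(a, i)\<in>?B. if i = b then if p * real a + q * real i = w then taylor_coeff S a i * c ^ a else 0 else 0)"
  proof (rule sum.mono_neutral_cong_left[OF _ sub], goal_cases)
    case 2
    have zero: "(if i = b then if p * real a + q * real i = w then taylor_coeff S a i * c ^ a else 0 else 0) = 0"
      if "(real a, real i) \<notin> e" for a i
      using e(2)[of a i] that by (cases "p * real a + q * real i = w") auto
    show ?case
    proof (intro ballI)
      fix z assume z: "z \<in> ?B - ?I"
      obtain a i where ai: "z = (a, i)" by (cases z)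
      have "(real a, real i) \<notin> e" using z by (simp add: ai)
      from zero[OF this] show "(case z of (a, i) \<Rightarrow> if i = b then if p * real a + q * real i = w
          then taylor_coeff S a i * c ^ a else 0 else 0) = 0" unfolding ai prod.case .
    qed
  next
    case (3 z)
    then show ?case using e(1) by (cases z) auto
  qed auto
  also have "\<dots> = (\<Sum>a<N. \<Sum>i<N + Suc b. if i = b then if p * real a + q * real i = w then taylor_coeff S a i * c ^ a else 0 else 0)"
    by (rule sum.cartesian_product[symmetric])
  also have "\<dots> = (\<Sum>a<N. if p * real a + q * real b = w then taylor_coeff S a b * c ^ a else 0)"
    by (simp add: sum.delta)
  finally show ?thesis .
qed

text \<open>Links the limit at u = c to the polynomial about which superadaptedness speaks. The
  factor (b + k)! / b! arises on both sides, from \<open>pderiv\<close> and from the Taylor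
  coefficients of the k-th y-derivative.\<close>

lemma poly_higher_pderiv_edge_poly:
  assumes pq: "p > 0" "q > 0" "w < p * real N" "w < q * real N"
    and e: "e \<subseteq> {z. p * fst z + q * snd z = w}"
      "\<And>a b. taylor_coeff S a b \<noteq> 0 \<Longrightarrow> p * real a + q * real b = w \<Longrightarrow> (real a, real b) \<in> e"
  shows "poly ((pderiv ^^ k) (edge_poly S e c)) r = scaled_deriv_limit S p q w N k c r"
proof -
  have co: "coeff (edge_poly S e c) b =
    (\<Sum>a<N. if p * real a + q * real b = w then taylor_coeff S a b * c ^ a else 0)" for b
    by (rule coeff_edge_poly[OF pq e(1)]) (rule e(2))
  have poch: "pochhammer (of_nat (Suc b)) k = (fact (b + k) / fact b :: real)" for b
  proof -
    have "fact (b + k) = (fact b :: real) * pochhammer (of_nat (Suc b)) k"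
      using pochhammer_product[of b "b + k" "1::real"] by (simp add: pochhammer_fact)
    then show ?thesis by simp
  qed
  have "poly ((pderiv ^^ k) (edge_poly S e c)) r = (\<Sum>b<N. coeff ((pderiv ^^ k) (edge_poly S e c)) b * r ^ b)"
  proof (rule poly_eq_sum_coeff)
    fix i assume "i \<ge> N"
    then have "p * real a + q * real (i + k) \<noteq> w" for a using line_index_less(2)[OF pq, of a "i + k"] by auto
    then show "coeff ((pderiv ^^ k) (edge_poly S e c)) i = 0"
      unfolding coeff_higher_pderiv co by (simp del: of_nat_add)
  qed
  also have "\<dots> = scaled_deriv_limit S p q w N k c r"
    unfolding scaled_deriv_limit_def coeff_higher_pderiv co poch taylor_coeff_higher_partial_y sum_distrib_left sum_distrib_right
    by (intro sum.cong refl) (simp del: of_nat_add)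
  finally show ?thesis .
qed

text \<open>Either a single monomial lies on the line, and the limit has no zeros off the axes, or
  the face on the line is a genuine compact edge through (d, d), where superadaptedness keeps the
  root orders below d.\<close>

lemma edge_order_bound:
  assumes sa: "superadapted S" and d: "d = newton_distance S" "d > 0"
    and pq: "p > 0" "q > 0" "w < p * real N" "w < q * real N"
    and supp: "\<And>a b. taylor_coeff S a b \<noteq> 0 \<Longrightarrow> w \<le> p * real a + q * real b"
    and dN: "(d, d) \<in> newton_polygon S" "p * d + q * d = w"
    and nz: "taylor_coeff S a0 b0 \<noteq> 0" "p * real a0 + q * real b0 = w"
    and c: "c \<in> {1, -1}" "r \<noteq> 0"
  shows "\<exists>k. real k < d \<and> scaled_deriv_limit S p q w N k c r \<noteq> 0"
proof (cases "\<forall>a b. taylor_coeff S a b \<noteq> 0 \<longrightarrow> p * real a + q * real b = w \<longrightarrow> a = a0 \<and> b = b0")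
  case True
  then have "scaled_deriv_limit S p q w N 0 c r = taylor_coeff S a0 b0 * c ^ a0 * r ^ b0"
    by (intro scaled_deriv_limit_0_single[OF pq nz(2)]) blast
  then show ?thesis using nz c d by (intro exI[of _ 0]) auto
next
  case False
  then obtain a1 b1 where P1: "taylor_coeff S a1 b1 \<noteq> 0" "p * real a1 + q * real b1 = w" "(a1, b1) \<noteq> (a0, b0)"
    by blast
  define e where "e = newton_polygon S \<inter> {z. p * fst z + q * snd z = w}"
  define A where "A = {(real a, real b) |a b. taylor_coeff S a b \<noteq> 0 \<and> p * real a + q * real b = w}"
  have ell: "w \<le> p * fst z + q * snd z" if "z \<in> newton_polygon S" for z
  proof -
    have "newton_polygon S \<subseteq> {z. w < p * fst z + q * snd z} \<union> ({z. p * fst z + q * snd z = w} \<inter> UNIV)"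
    proof (rule newton_polygon_subset[OF convex_lex_halfspace[OF convex_UNIV]])
      fix a b t1 t2 assume t: "taylor_coeff S a b \<noteq> 0" "real a \<le> t1" "real b \<le> t2"
      have "p * real a \<le> p * t1" "q * real b \<le> q * t2" using t pq by auto
      then show "(t1, t2) \<in> {z. w < p * fst z + q * snd z} \<union> ({z. p * fst z + q * snd z = w} \<inter> UNIV)"
        using supp[OF t(1)] by auto
    qed
    then show ?thesis using that by force
  qed
  have in_e: "(real a, real b) \<in> e" if "taylor_coeff S a b \<noteq> 0" "p * real a + q * real b = w" for a b
    using newton_polygon_quadrant[OF that(1)] that(2) by (auto simp: e_def)
  have face: "e face_of newton_polygon S" "aff_dim e \<le> 1"
    unfolding e_def using ell pq by (auto intro!: newton_polygon_line_face)
  have "aff_dim {(real a0, real b0), (real a1, real b1)} \<le> aff_dim e"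
    using in_e nz P1 by (intro aff_dim_subset) auto
  then have "aff_dim e = 1" using face(2) P1(3) by auto
  moreover have "compact e"
  proof -
    have "A \<subseteq> (\<lambda>(a, b). (real a, real b)) ` ({..<N} \<times> {..<N})"
      unfolding A_def using line_index_less[OF pq] by fastforce
    then have "finite A" by (rule finite_subset) auto
    have "e \<subseteq> convex hull A" unfolding e_def
      by (rule newton_polygon_supporting_face_subset[OF pq(1,2) _ convex_convex_hull])
        (auto simp: A_def intro!: hull_inc supp)
    moreover have "convex hull A \<subseteq> e"
      using in_e face_of_imp_convex[OF face(1)] by (intro hull_minimal) (auto simp: A_def)
    ultimately have "e = convex hull A" by blast
    then show ?thesis using finite_imp_compact_convex_hull[OF \<open>finite A\<close>] by simp
  qed
  ultimately have ce: "compact_edge e S" using face(1) by (simp add: compact_edge_def edge_of_def)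
  have bis: "bisectrix_point S \<in> e" using dN by (simp add: bisectrix_point_def d(1)[symmetric] e_def)
  have sub: "e \<subseteq> {z. p * fst z + q * snd z = w}" by (auto simp: e_def)
  let ?Q = "edge_poly S e c"
  \<comment> \<open>The line meets the row b0 only at a0, so this coefficient is a single term and
    cannot cancel. The polynomial is therefore nonzero, and its root order is meaningful.\<close>
  have "coeff ?Q b0 = (\<Sum>a<N. if p * real a + q * real b0 = w then taylor_coeff S a b0 * c ^ a else 0)"
    by (rule coeff_edge_poly[OF pq sub]) (rule in_e)
  also have "\<dots> = (\<Sum>a<N. if a = a0 then taylor_coeff S a b0 * c ^ a else 0)"
    using nz(2) pq by (intro sum.cong refl if_cong) (auto dest: sym)
  also have "\<dots> \<noteq> 0" using line_index_less[OF pq nz(2)] nz(1) c by (auto simp: sum.delta)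
  finally have "?Q \<noteq> 0" by auto
  then obtain k where k: "k \<le> order r ?Q" "poly ((pderiv ^^ k) ?Q) r \<noteq> 0"
    using higher_pderiv_nonzero_at_order by blast
  have "real (order r ?Q) < d"
  \<comment> \<open>Superadaptedness speaks of roots only; at a non-root the order is 0, which is
    below d.\<close>
  proof (cases "poly ?Q r = 0")
    case True
    then have "\<not> real (order r ?Q) \<ge> newton_distance S"
      using sa ce bis c unfolding superadapted_def by blast
    then show ?thesis using d by simp
  next
    case False
    then show ?thesis using d order_root[of ?Q r] by auto
  qed
  then have "real k < d" using k(1) by linarith
  moreover have "poly ((pderiv ^^ k) ?Q) r = scaled_deriv_limit S p q w N k c r"
    by (rule poly_higher_pderiv_edge_poly[OF pq sub]) (rule in_e)
  ultimately show ?thesis using k(2) by auto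
qed

lemma admissible_weights_bisectrix:
  assumes sa: "superadapted S" and S0: "S (0, 0) = 0" and d: "d = newton_distance S" "d > 0"
    and pq: "p > 0" "q > 0"
    and supp: "\<And>z. z \<in> newton_polygon S \<Longrightarrow> p * d + q * d \<le> p * fst z + q * snd z"
    and dN: "(d, d) \<in> newton_polygon S"
    and K: "K \<ge> 1" "\<And>m. real m < d \<Longrightarrow> m \<le> K"
    and A: "taylor_coeff S a0 b0 \<noteq> 0" "p * real a0 + q * real b0 = p * d + q * d" "a0 \<le> K"
    and B: "taylor_coeff S a1 b1 \<noteq> 0" "p * real a1 + q * real b1 = p * d + q * d" "b1 \<le> K"
  shows "admissible_weights S p q (p * d + q * d) K"
  unfolding admissible_weights_def
proof (intro conjI allI impI)
  show "p * d + q * d > 0" using pq d by (intro add_pos_pos) auto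
  have supp': "p * d + q * d \<le> p * real a + q * real b" if "taylor_coeff S a b \<noteq> 0" for a b
    using supp[OF newton_polygon_quadrant[OF that order_refl order_refl]] by simp
  then show "taylor_coeff S a b \<noteq> 0 \<Longrightarrow> p * d + q * d \<le> p * real a + q * real b" for a b .
  fix N :: nat and c r :: real
  assume N: "p * d + q * d < p * real N" "p * d + q * d < q * real N" and c: "c \<in> {1, -1}" "r \<noteq> 0"
  have "\<exists>k. real k < d \<and> scaled_deriv_limit S p q (p * d + q * d) N k c r \<noteq> 0"
    by (rule edge_order_bound[OF sa d pq N _ dN refl A(1,2) c]) (rule supp')
  then show "\<exists>k\<le>K. scaled_deriv_limit S p q (p * d + q * d) N k c r \<noteq> 0" using K(2) by blast
qed (use assms in blast)+

subsection \<open>The three cases\<close>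

text \<open>Compactness of the edge excludes horizontal and vertical lines. Since (d, d) is in its
  relative interior, the line carries monomials with a < d and with b < d, as the axes
  require.\<close>

lemma case1_weights:
  assumes c1: "case1 S" and sa: "superadapted S" and S0: "S (0, 0) = 0" and d: "d = newton_distance S" "d > 1"
    and nz: "taylor_coeff S a0 b0 \<noteq> 0"
  shows "\<exists>p q K. real K < d \<and> admissible_weights S p q (d * (p + q)) K"
proof -
  obtain e where e: "e edge_of newton_polygon S" "compact e" "(d, d) \<in> rel_interior e"
    using c1 d(1) unfolding case1_def compact_edge_def bisectrix_point_def by auto
  obtain \<alpha> \<beta> where ab: "\<alpha> \<ge> 0" "\<beta> \<ge> 0" "(\<alpha>, \<beta>) \<noteq> (0::real, 0::real)"
    "\<And>z. z \<in> newton_polygon S \<Longrightarrow> \<alpha> * d + \<beta> * d \<le> \<alpha> * fst z + \<beta> * snd z"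
    and eF: "e = newton_polygon S \<inter> {z. \<alpha> * fst z + \<beta> * snd z = \<alpha> * d + \<beta> * d}"
    by (rule newton_polygon_edge_line[OF e(1,3) nz]) blast
  have dN: "(d, d) \<in> newton_polygon S" using e(3) rel_interior_subset eF by blast
  obtain M where M: "\<And>z. z \<in> e \<Longrightarrow> norm z \<le> M"
    using compact_imp_bounded[OF e(2)] unfolding bounded_iff by blast
  have "norm (d, d) \<le> M" using M dN eF by auto
  then have M0: "M \<ge> 0" using norm_ge_zero order_trans by blast
  have pos: "\<alpha> > 0" "\<beta> > 0"
  proof -
    \<comment> \<open>Were a weight zero, moving (d, d) by M along the line would stay in e but
      leave the ball of radius M containing it.\<close>
    have "\<alpha> \<noteq> 0"
    proof
      assume "\<alpha> = 0"
      then have "(d + M, d) \<in> e" using newton_polygon_upward[OF dN, of "d + M" d] M0 by (simp add: eF)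
      then show False using M[of "(d + M, d)"] norm_fst_le[of "d + M" d] d(2) by simp
    qed
    moreover have "\<beta> \<noteq> 0"
    proof
      assume "\<beta> = 0"
      then have "(d, d + M) \<in> e" using newton_polygon_upward[OF dN, of d "d + M"] M0 by (simp add: eF)
      then show False using M[of "(d, d + M)"] norm_snd_le[of "d + M" d] d(2) by simp
    qed
    ultimately show "\<alpha> > 0" "\<beta> > 0" using ab by auto
  qed
  let ?w = "\<alpha> * d + \<beta> * d"
  have supp: "?w \<le> \<alpha> * real a + \<beta> * real b" if "taylor_coeff S a b \<noteq> 0" for a b
    using ab(4)[OF newton_polygon_quadrant[OF that order_refl order_refl]] by simp
  have conv: "convex e" using e(1) by (auto simp: edge_of_def intro: face_of_imp_convex)
  obtain y where y: "y \<in> e" "y \<noteq> (d, d)"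
    using edge_has_other_point e(1) unfolding edge_of_def by blast
  have yl: "\<alpha> * fst y + \<beta> * snd y = ?w" using y eF by auto
  have y1: "fst y \<noteq> d"
  proof
    assume "fst y = d"
    then have "snd y = d" using yl pos by simp
    then show False using y(2) \<open>fst y = d\<close> by (metis prod.collapse)
  qed
  have y2: "snd y \<noteq> d"
  proof
    assume "snd y = d"
    then have "fst y = d" using yl pos by simp
    then show False using y1 by simp
  qed
  \<comment> \<open>If all monomials on the line had a >= d, the whole edge would lie in that
    half-plane, whereas it continues beyond (d, d) to smaller first coordinates.\<close>
  have "\<exists>a b. taylor_coeff S a b \<noteq> 0 \<and> \<alpha> * real a + \<beta> * real b = ?w \<and> real a < d"
  proof (rule ccontr)
    assume contra: "\<not> ?thesis"
    have "e \<subseteq> {d..} \<times> UNIV" unfolding eF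
      by (rule newton_polygon_supporting_face_subset[OF pos supp])
        (use contra in \<open>force intro: convex_Times\<close>)+
    moreover obtain z where "z \<in> e" "fst z < d"
      using rel_interior_beyond[OF conv e(3) y(1) linear_fst] y1 by auto
    ultimately show False by auto
  qed
  then obtain a1 b1 where A: "taylor_coeff S a1 b1 \<noteq> 0" "\<alpha> * real a1 + \<beta> * real b1 = ?w" "real a1 < d" by blast
  have "\<exists>a b. taylor_coeff S a b \<noteq> 0 \<and> \<alpha> * real a + \<beta> * real b = ?w \<and> real b < d"
  proof (rule ccontr)
    assume contra: "\<not> ?thesis"
    have "e \<subseteq> UNIV \<times> {d..}" unfolding eF
      by (rule newton_polygon_supporting_face_subset[OF pos supp])
        (use contra in \<open>force intro: convex_Times\<close>)+
    moreover obtain z where "z \<in> e" "snd z < d"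
      using rel_interior_beyond[OF conv e(3) y(1) linear_snd] y2 by auto
    ultimately show False by auto
  qed
  then obtain a2 b2 where B: "taylor_coeff S a2 b2 \<noteq> 0" "\<alpha> * real a2 + \<beta> * real b2 = ?w" "real b2 < d" by blast
  \<comment> \<open>The largest integer strictly below d; it is at least 1 because d > 1.\<close>
  define K where "K = nat (\<lceil>d\<rceil> - 1)"
  have K: "K \<ge> 1" "real K < d" "\<And>m. real m < d \<Longrightarrow> m \<le> K"
    using d(2) unfolding K_def by linarith+
  have "admissible_weights S \<alpha> \<beta> ?w K"
    using d(2) A B K ab(4)
    by (intro admissible_weights_bisectrix[OF sa S0 d(1) _ pos _ dN, of K a1 b1 a2 b2]) auto
  then show ?thesis using K(2) by (intro exI[of _ \<alpha>] exI[of _ \<beta>] exI[of _ K]) (simp add: algebra_simps)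
qed

text \<open>An extreme point of a hull belongs to one of the generating quadrants, and being extreme
  it must be the corner. So d is an integer and the monomial with exponents (d, d) occurs, which
  makes K = d possible.\<close>

lemma case2_weights:
  assumes c2: "case2 S" and sa: "superadapted S" and S0: "S (0, 0) = 0" and d: "d = newton_distance S" "d > 1"
    and nz: "taylor_coeff S a0 b0 \<noteq> 0"
  shows "\<exists>p q K. real K = d \<and> admissible_weights S p q (d * (p + q)) K"
proof -
  have ext: "(d, d) extreme_point_of newton_polygon S"
    using c2 d(1) unfolding case2_def bisectrix_point_def by auto
  have dN: "(d, d) \<in> newton_polygon S" using ext unfolding extreme_point_of_def by blast
  have no_mid: "False" if "x \<in> newton_polygon S" "y \<in> newton_polygon S" "x \<noteq> y" "0 < u" "u < 1"
      "(d, d) = (1 - u) *\<^sub>R x + u *\<^sub>R y" for x y u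
    using ext that unfolding extreme_point_of_def in_segment by blast
  \<comment> \<open>Otherwise (d, d) would be the midpoint of (t, d) and its reflection, which lies
    in the polygon by upward closure.\<close>
  have no_x: "(t, d) \<notin> newton_polygon S" if "t < d" for t
  proof
    assume "(t, d) \<in> newton_polygon S"
    moreover have "(2 * d - t, d) \<in> newton_polygon S" using newton_polygon_upward[OF dN, of "2 * d - t" d] that by simp
    ultimately show False using that by (intro no_mid[of "(t, d)" "(2 * d - t, d)" "1/2"]) (auto simp: algebra_simps)
  qed
  have no_y: "(d, t) \<notin> newton_polygon S" if "t < d" for t
  proof
    assume "(d, t) \<in> newton_polygon S"
    moreover have "(d, 2 * d - t) \<in> newton_polygon S" using newton_polygon_upward[OF dN, of d "2 * d - t"] that by simp
    ultimately show False using that by (intro no_mid[of "(d, t)" "(d, 2 * d - t)" "1/2"]) (auto simp: algebra_simps)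
  qed
  have "\<exists>a b. taylor_coeff S a b \<noteq> 0 \<and> real a \<le> d \<and> real b \<le> d"
    using extreme_point_of_convex_hull[OF ext[unfolded newton_polygon_def]] by auto
  then obtain K K' where KK: "taylor_coeff S K K' \<noteq> 0" "real K \<le> d" "real K' \<le> d" by blast
  have "real K = d"
    using no_x[of "real K"] newton_polygon_quadrant[OF KK(1), of "real K" d] KK by force
  moreover have "real K' = d"
    using no_y[of "real K'"] newton_polygon_quadrant[OF KK(1), of d "real K'"] KK by force
  ultimately have K: "taylor_coeff S K K \<noteq> 0" "real K = d" using KK by auto
  have K1: "K \<ge> 1" using K(2) d(2) by linarith
  have "newton_polygon S \<noteq> {(d, d)}"
    using aff_dim_newton_polygon[OF nz] by auto
  then have "(d, d) \<notin> rel_interior (newton_polygon S)"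
    by (rule extreme_point_not_in_REL_INTERIOR[OF ext])
  then obtain \<alpha> \<beta> where ab: "\<alpha> \<ge> 0" "\<beta> \<ge> 0" "(\<alpha>, \<beta>) \<noteq> (0::real, 0::real)"
    "\<And>z. z \<in> newton_polygon S \<Longrightarrow> \<alpha> * d + \<beta> * d \<le> \<alpha> * fst z + \<beta> * snd z"
    by (rule newton_polygon_supporting_line[OF dN]) blast
  have supp: "\<alpha> * d + \<beta> * d \<le> \<alpha> * real a + \<beta> * real b" if "taylor_coeff S a b \<noteq> 0" for a b
    using ab(4)[OF newton_polygon_quadrant[OF that order_refl order_refl]] by simp
  \<comment> \<open>An oblique line is used as it is. A horizontal or vertical one has a zero weight
    and is tilted about (d, d); as the pivot is on the bisectrix, w = d (p + q) persists.\<close>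
  consider "\<alpha> > 0" "\<beta> > 0" | "\<alpha> = 0" "\<beta> > 0" | "\<alpha> > 0" "\<beta> = 0" using ab by force
  then show ?thesis
  proof cases
    case 1
    have "admissible_weights S \<alpha> \<beta> (\<alpha> * d + \<beta> * d) K"
      using d(2) K K1 ab(4)
      by (intro admissible_weights_bisectrix[OF sa S0 d(1) _ 1 _ dN, of K K K K K]) auto
    then show ?thesis using K(2) by (intro exI[of _ \<alpha>] exI[of _ \<beta>] exI[of _ K]) (simp add: algebra_simps)
  next
    case 2
    have "admissible_weights S 1 (real K + 1) (real K + (real K + 1) * real K) K"
    proof (rule admissible_weights_bottom_vertex[OF S0 K1 order_refl K(1)])
      show "K \<le> b" if "taylor_coeff S a b \<noteq> 0" for a b using supp[OF that] 2 K(2) by simp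
      show "K \<le> a" if "taylor_coeff S a K \<noteq> 0" for a
        using no_x[of "real a"] newton_polygon_quadrant[OF that, of "real a" d] K(2) by force
    qed
    moreover have "real K + (real K + 1) * real K = d * (1 + (real K + 1))" by (simp add: K(2) algebra_simps)
    ultimately show ?thesis using K(2) by metis
  next
    case 3
    have "admissible_weights S (real K + 1) 1 (real K + (real K + 1) * real K) K"
    proof (rule admissible_weights_left_vertex[OF S0 K1 order_refl K(1)])
      show "K \<le> a" if "taylor_coeff S a b \<noteq> 0" for a b using supp[OF that] 3 K(2) by simp
      show "K \<le> b" if "taylor_coeff S K b \<noteq> 0" for b
        using no_y[of "real b"] newton_polygon_quadrant[OF that, of d "real b"] K(2) by force
    qed
    moreover have "real K + (real K + 1) * real K = d * (real K + 1 + 1)" by (simp add: K(2) algebra_simps)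
    ultimately show ?thesis using K(2) by metis
  qed
qed

text \<open>The line of an unbounded edge is horizontal or vertical. It is tilted about the vertex
  where the ray starts, which is off the bisectrix; the new line crosses the bisectrix below (d, d),
  and this is the gain w < d (p + q).\<close>

lemma case3_weights:
  assumes c3: "case3 S" and S0: "S (0, 0) = 0" and d: "d = newton_distance S" "d > 1"
    and nz: "taylor_coeff S a0 b0 \<noteq> 0"
  shows "\<exists>p q w K. real K = d \<and> w < d * (p + q) \<and> admissible_weights S p q w K"
proof -
  obtain e where e: "e edge_of newton_polygon S" "\<not> bounded e" "(d, d) \<in> rel_interior e"
    using c3 d(1) unfolding case3_def unbounded_ray_def bisectrix_point_def by auto
  obtain \<alpha> \<beta> where ab: "\<alpha> \<ge> 0" "\<beta> \<ge> 0" "(\<alpha>, \<beta>) \<noteq> (0::real, 0::real)"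
    "\<And>z. z \<in> newton_polygon S \<Longrightarrow> \<alpha> * d + \<beta> * d \<le> \<alpha> * fst z + \<beta> * snd z"
    and eF: "e = newton_polygon S \<inter> {z. \<alpha> * fst z + \<beta> * snd z = \<alpha> * d + \<beta> * d}"
    by (rule newton_polygon_edge_line[OF e(1,3) nz]) blast
  let ?w = "\<alpha> * d + \<beta> * d"
  have supp: "?w \<le> \<alpha> * real a + \<beta> * real b" if "taylor_coeff S a b \<noteq> 0" for a b
    using ab(4)[OF newton_polygon_quadrant[OF that order_refl order_refl]] by simp
  have conv: "convex e" using e(1) by (auto simp: edge_of_def intro: face_of_imp_convex)
  obtain y where y: "y \<in> e" "y \<noteq> (d, d)"
    using edge_has_other_point e(1) unfolding edge_of_def by blast
  have yl: "\<alpha> * fst y + \<beta> * snd y = ?w" using y eF by auto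
  \<comment> \<open>Positive weights would confine the face to a bounded rectangle, since the
    polygon lies in the first quadrant.\<close>
  have "\<not> (\<alpha> > 0 \<and> \<beta> > 0)"
  proof
    assume pos: "\<alpha> > 0 \<and> \<beta> > 0"
    have "e \<subseteq> {0..?w / \<alpha>} \<times> {0..?w / \<beta>}"
    proof
      fix z assume z: "z \<in> e"
      then have nn: "0 \<le> fst z" "0 \<le> snd z" using newton_polygon_nonneg eF by blast+
      have zl: "\<alpha> * fst z + \<beta> * snd z = ?w" using z eF by auto
      have "0 \<le> \<alpha> * fst z" "0 \<le> \<beta> * snd z" using nn pos by simp_all
      then have "\<alpha> * fst z \<le> ?w" "\<beta> * snd z \<le> ?w" using zl by linarith+
      then have "fst z \<le> ?w / \<alpha>" "snd z \<le> ?w / \<beta>" using pos by (simp_all add: field_simps)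
      then show "z \<in> {0..?w / \<alpha>} \<times> {0..?w / \<beta>}" using nn by (simp add: mem_Times_iff)
    qed
    then show False using e(2) bounded_subset bounded_Times bounded_closed_interval by metis
  qed
  then consider "\<alpha> = 0" "\<beta> > 0" | "\<alpha> > 0" "\<beta> = 0" using ab by force
  then show ?thesis
  proof cases
    case 1
    have line: "snd z = d" if "z \<in> e" for z using that 1 eF by auto
    have low: "d \<le> real b" if "taylor_coeff S a b \<noteq> 0" for a b using supp[OF that] 1 by simp
    have "fst y \<noteq> d" using line[OF y(1)] y(2) by (metis prod.collapse)
    then obtain z where z: "z \<in> e" "fst z < d"
      using rel_interior_beyond[OF conv e(3) y(1) linear_fst] by auto
    have "z = (fst z, d)" using line[OF z(1)] by (metis prod.collapse)
    then have "(fst z, d) \<in> newton_polygon S" using z(1) eF by auto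
    then have "\<exists>a b. taylor_coeff S a b \<noteq> 0 \<and> real b = d \<and> real a \<le> fst z"
      using low by (intro newton_polygon_bottom)
    then obtain a K
      where aK: "taylor_coeff S a K \<noteq> 0" "real K = d" "real a \<le> fst z" by blast
    \<comment> \<open>The leftmost monomial of the bottom row is the vertex at which the ray
      starts.\<close>
    define a' where "a' = (LEAST a. taylor_coeff S a K \<noteq> 0)"
    have a': "taylor_coeff S a' K \<noteq> 0" unfolding a'_def by (rule LeastI[of "\<lambda>a. taylor_coeff S a K \<noteq> 0", OF aK(1)])
    have least: "a' \<le> i" if "taylor_coeff S i K \<noteq> 0" for i unfolding a'_def by (rule Least_le[of "\<lambda>a. taylor_coeff S a K \<noteq> 0", OF that])
    have lt: "real a' < d" using least[OF aK(1)] aK(3) z(2) by linarith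
    have "admissible_weights S 1 (real a' + 1) (real a' + (real a' + 1) * real K) K"
    proof (rule admissible_weights_bottom_vertex[OF S0 _ _ a'])
      show "K \<ge> 1" "a' \<le> K" using aK(2) d(2) lt by linarith+
      show "K \<le> b" if "taylor_coeff S a b \<noteq> 0" for a b using low[OF that] aK(2) by linarith
    qed (rule least)
    moreover have "real a' + (real a' + 1) * real K < d * (1 + (real a' + 1))"
      using lt by (simp add: aK(2) algebra_simps)
    ultimately show ?thesis using aK(2) by blast
  next
    case 2
    have line: "fst z = d" if "z \<in> e" for z using that 2 eF by auto
    have low: "d \<le> real a" if "taylor_coeff S a b \<noteq> 0" for a b using supp[OF that] 2 by simp
    have "snd y \<noteq> d" using line[OF y(1)] y(2) by (metis prod.collapse)
    then obtain z where z: "z \<in> e" "snd z < d"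
      using rel_interior_beyond[OF conv e(3) y(1) linear_snd] by auto
    have "z = (d, snd z)" using line[OF z(1)] by (metis prod.collapse)
    then have "(d, snd z) \<in> newton_polygon S" using z(1) eF by auto
    then have "\<exists>a b. taylor_coeff S a b \<noteq> 0 \<and> real a = d \<and> real b \<le> snd z"
      using low by (intro newton_polygon_left)
    then obtain K b
      where aK: "taylor_coeff S K b \<noteq> 0" "real K = d" "real b \<le> snd z" by blast
    define b' where "b' = (LEAST b. taylor_coeff S K b \<noteq> 0)"
    have b': "taylor_coeff S K b' \<noteq> 0" unfolding b'_def by (rule LeastI[of "\<lambda>b. taylor_coeff S K b \<noteq> 0", OF aK(1)])
    have least: "b' \<le> i" if "taylor_coeff S K i \<noteq> 0" for i unfolding b'_def by (rule Least_le[of "\<lambda>b. taylor_coeff S K b \<noteq> 0", OF that])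
    have lt: "real b' < d" using least[OF aK(1)] aK(3) z(2) by linarith
    have "admissible_weights S (real b' + 1) 1 (real b' + (real b' + 1) * real K) K"
    proof (rule admissible_weights_left_vertex[OF S0 _ _ b'])
      show "K \<ge> 1" "b' \<le> K" using aK(2) d(2) lt by linarith+
      show "K \<le> a" if "taylor_coeff S a b \<noteq> 0" for a b using low[OF that] aK(2) by linarith
    qed (rule least)
    moreover have "real b' + (real b' + 1) * real K < d * (real b' + 1 + 1)"
      using lt by (simp add: aK(2) algebra_simps)
    ultimately show ?thesis using aK(2) by blast
  qed
qed

subsection \<open>The sublevel estimate\<close>

text \<open>All monomials of the limit lie on one line, hence quasi-homogeneity; the dilation
  parameter \<open>ln \<bar>u\<bar> / p\<close> is the one that moves u to its sign.\<close>

lemma scaled_deriv_limit_homogeneous: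
  assumes p: "p > 0" and u: "u \<noteq> 0"
  shows "scaled_deriv_limit S p q w N k u v
    = exp (ln \<bar>u\<bar> / p * (w - q * real k)) * scaled_deriv_limit S p q w N k (sgn u) (v * exp (- (q * (ln \<bar>u\<bar> / p))))"
proof -
  define s where "s = ln \<bar>u\<bar> / p"
  have ua: "u ^ a = sgn u ^ a * exp (s * (p * real a))" for a
  proof -
    have "\<bar>u\<bar> ^ a = exp (ln \<bar>u\<bar>) ^ a" using u by simp
    also have "\<dots> = exp (real a * ln \<bar>u\<bar>)" by (rule exp_of_nat_mult[symmetric])
    also have "real a * ln \<bar>u\<bar> = s * (p * real a)" using p by (simp add: s_def)
    finally have "\<bar>u\<bar> ^ a = exp (s * (p * real a))" .
    moreover have "u ^ a = sgn u ^ a * \<bar>u\<bar> ^ a"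
      by (metis power_mult_distrib sgn_mult_abs)
    ultimately show ?thesis by simp
  qed
  have vb: "v ^ b = (v * exp (- (q * s))) ^ b * exp (s * (q * real b))" for b
    by (simp add: power_mult_distrib mult_ac flip: exp_of_nat_mult exp_add)
  have t: "(if p * real a + q * real (b + k) = w then g * u ^ a * v ^ b else 0) =
    exp (s * (w - q * real k)) * (if p * real a + q * real (b + k) = w then g * sgn u ^ a * (v * exp (- (q * s))) ^ b else 0)"
    for a b and g :: real
  proof (cases "p * real a + q * real (b + k) = w")
    case True
    then have "w - q * real k = p * real a + q * real b" by (simp add: algebra_simps)
    then have "exp (s * (w - q * real k)) = exp (s * (p * real a)) * exp (s * (q * real b))"
      by (simp add: distrib_left flip: exp_add)
    then show ?thesis unfolding ua[of a] vb[of b] by (simp add: mult_ac)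
  qed simp
  show ?thesis unfolding scaled_deriv_limit_def s_def[symmetric] sum_distrib_left t ..
qed

text \<open>At v = 0 only the terms with b = 0 remain, and the row of exponent k meets the line in
  one point, so nothing can cancel.\<close>

lemma scaled_deriv_limit_axis:
  assumes pq: "p > 0" "q > 0" "w < p * real N" "w < q * real N"
    and nz: "taylor_coeff S a0 k \<noteq> 0" "p * real a0 + q * real k = w" and u: "u \<noteq> 0"
  shows "scaled_deriv_limit S p q w N k u 0 \<noteq> 0"
proof -
  have N: "a0 < N" "0 < N" using line_index_less[OF pq nz(2)] by auto
  have "(if p * real a + q * real (b + k) = w then taylor_coeff ((partial_y ^^ k) S) a b * u ^ a * 0 ^ b else 0)
    = (if a = a0 then if b = 0 then taylor_coeff ((partial_y ^^ k) S) a0 0 * u ^ a0 else 0 else 0)" for a b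
  proof (cases "b = 0")
    case True
    have "p * real a + q * real k = w \<longleftrightarrow> a = a0" using nz(2) pq(1) by auto
    then show ?thesis using True by simp
  qed simp
  then have "scaled_deriv_limit S p q w N k u 0 = taylor_coeff ((partial_y ^^ k) S) a0 0 * u ^ a0"
    unfolding scaled_deriv_limit_def using N by (simp add: sum.delta)
  then show ?thesis using nz u by (simp add: taylor_coeff_higher_partial_y)
qed

lemma local_bound_annulus:
  assumes S: "smooth_on S U" and U: "open U" "(0, 0) \<in> U" and aw: "admissible_weights S p q w K"
  shows "local_bound S U p q w K (annulus p q)"
proof (rule local_bound_compact[OF smooth_on_imp_continuous_on[OF S] U(1) compact_annulus])
  fix z assume z: "z \<in> annulus p q"
  obtain u v where uv: "z = (u, v)" by (cases z)
  have le: "\<bar>u\<bar> \<le> 1" "\<bar>v\<bar> \<le> 1" and nz: "u \<noteq> 0 \<or> v \<noteq> 0"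
    using z by (auto simp: uv annulus_def)
  have pq: "p > 0" "q > 0" "K \<ge> 1" and supp: "\<And>a b. taylor_coeff S a b \<noteq> 0 \<Longrightarrow> w \<le> p * real a + q * real b"
    using aw unfolding admissible_weights_def by auto
  obtain N1 N2 :: nat where "w / p < real N1" "w / q < real N2" using reals_Archimedean2 by metis
  then have "w / p < real (max N1 N2)" "w / q < real (max N1 N2)" by auto
  then obtain N where N: "w < p * real N" "w < q * real N" using pq by (auto simp: field_simps)
  have "\<exists>\<delta>>0. local_bound S U p q w K ({u - \<delta><..<u + \<delta>} \<times> {v - \<delta><..<v + \<delta>})"
  proof (cases "u = 0")
    case False
    have "\<exists>k\<le>K. scaled_deriv_limit S p q w N k u v \<noteq> 0"
    proof (cases "v = 0")
      case True
      obtain a b where "taylor_coeff S a b \<noteq> 0" "p * real a + q * real b = w" "b \<le> K"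
        using aw unfolding admissible_weights_def by blast
      then show ?thesis using scaled_deriv_limit_axis[OF pq(1,2) N] False True by blast
    next
      case v: False
      have "sgn u \<in> {1, -1}" "v * exp (- (q * (ln \<bar>u\<bar> / p))) \<noteq> 0" using False v by (auto simp: sgn_if)
      then obtain k where "k \<le> K" "scaled_deriv_limit S p q w N k (sgn u) (v * exp (- (q * (ln \<bar>u\<bar> / p)))) \<noteq> 0"
        using aw N unfolding admissible_weights_def by blast
      then show ?thesis using scaled_deriv_limit_homogeneous[OF pq(1) False] by force
    qed
    then obtain k where k: "k \<le> K" "scaled_deriv_limit S p q w N k u v \<noteq> 0" by blast
    show ?thesis by (rule local_bound_y[OF S U pq(1,2) _ N pq(3) k(1) le k(2)]) (rule supp)
  next
    case True
    obtain a b where ab: "taylor_coeff S a b \<noteq> 0" "p * real a + q * real b = w" "a \<le> K"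
      using aw unfolding admissible_weights_def by blast
    have "scaled_deriv_limit (S \<circ> prod.swap) q p w N a v 0 \<noteq> 0"
      using nz True ab taylor_coeff_swap[OF S U, of b a]
      by (intro scaled_deriv_limit_axis[OF pq(2,1) N(2,1), of _ b]) (auto simp: add.commute)
    then have D: "scaled_deriv_limit (S \<circ> prod.swap) q p w N a v u \<noteq> 0" using True by simp
    show ?thesis by (rule local_bound_x[OF S U pq(1,2) _ N pq(3) ab(3) le D]) (rule supp)
  qed
  then obtain \<delta> where \<delta>: "\<delta> > 0" "local_bound S U p q w K ({u - \<delta><..<u + \<delta>} \<times> {v - \<delta><..<v + \<delta>})" by blast
  then show "\<exists>B. open B \<and> z \<in> B \<and> local_bound S U p q w K B"
    by (intro exI[of _ "{u - \<delta><..<u + \<delta>} \<times> {v - \<delta><..<v + \<delta>}"]) (auto simp: uv intro: open_Times)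
qed

section \<open>From measures of sublevel sets to the integral\<close>

text \<open>Passing to |S| < \<epsilon> drops the positivity of S and only enlarges the set. V is
  chosen without reference to any cutoff function.\<close>

definition sublevel_bounded_by ::
    "(real \<times> real \<Rightarrow> real) \<Rightarrow> (real \<times> real) set \<Rightarrow> (real \<Rightarrow> real) \<Rightarrow> bool" where
  "sublevel_bounded_by S U h \<longleftrightarrow> (\<exists>V. open V \<and> (0, 0) \<in> V \<and> V \<subseteq> U \<and>
     (\<exists>B>0. \<forall>\<^sub>F \<epsilon> in at_right 0. emeasure lborel {z\<in>V. \<bar>S z\<bar> < \<epsilon>} \<le> ennreal (B * h \<epsilon>)))"

lemma sublevel_bounded_byI:
  assumes S: "smooth_on S U" and U: "open U" "(0, 0) \<in> U" and aw: "admissible_weights S p q w K"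
    and r: "r > 0" and sum: "\<And>C. C > 0 \<Longrightarrow> \<exists>B>0. \<forall>\<epsilon>. 0 < \<epsilon> \<longrightarrow> \<epsilon> < r \<longrightarrow>
       4 * exp (- (p + q) * real (nat \<lfloor>- ln \<epsilon> / w\<rfloor>)) +
       C * \<epsilon> powr (1 / real K) * (\<Sum>j<nat \<lfloor>- ln \<epsilon> / w\<rfloor>. exp ((w / real K - (p + q)) * real j)) \<le> B * h \<epsilon>"
  shows "sublevel_bounded_by S U h"
proof -
  have w: "w > 0" using aw unfolding admissible_weights_def by blast
  obtain V C where V: "open V" "(0, 0) \<in> V" "V \<subseteq> U" and C: "C > 0" "\<forall>\<^sub>F \<epsilon> in at_right 0.
     emeasure lborel {z\<in>V. \<bar>S z\<bar> < \<epsilon>} \<le> ennreal (4 * exp (- (p + q) * real (nat \<lfloor>- ln \<epsilon> / w\<rfloor>)) +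
       C * \<epsilon> powr (1 / real K) * (\<Sum>j<nat \<lfloor>- ln \<epsilon> / w\<rfloor>. exp ((w / real K - (p + q)) * real j)))"
    using sublevel_emeasure_bound[OF smooth_on_imp_continuous_on[OF S] U local_bound_annulus[OF S U aw] w] by blast
  obtain B where B: "B > 0" "\<And>\<epsilon>. 0 < \<epsilon> \<Longrightarrow> \<epsilon> < r \<Longrightarrow>
       4 * exp (- (p + q) * real (nat \<lfloor>- ln \<epsilon> / w\<rfloor>)) +
       C * \<epsilon> powr (1 / real K) * (\<Sum>j<nat \<lfloor>- ln \<epsilon> / w\<rfloor>. exp ((w / real K - (p + q)) * real j)) \<le> B * h \<epsilon>"
    using sum[OF C(1)] by blast
  have "\<forall>\<^sub>F \<epsilon> in at_right (0::real). \<epsilon> < r"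
    by (rule order_tendstoD(2)[of "\<lambda>x. x" 0]) (auto intro: tendsto_ident_at r)
  moreover have "\<forall>\<^sub>F \<epsilon> in at_right (0::real). \<epsilon> > 0" by (rule eventually_at_right_less)
  ultimately have "\<forall>\<^sub>F \<epsilon> in at_right 0. emeasure lborel {z\<in>V. \<bar>S z\<bar> < \<epsilon>} \<le> ennreal (B * h \<epsilon>)"
    using C(2)
  proof eventually_elim
    case (elim \<epsilon>)
    from elim(3) ennreal_leI[OF B(2)[OF elim(2,1)]] show ?case by (rule order_trans)
  qed
  then show ?thesis unfolding sublevel_bounded_by_def using V B(1) by blast
qed

lemma sublevel_integral_less:
  assumes S: "continuous_on U S" and U: "open U" and V: "open V" "V \<subseteq> U"
    and B: "B > 0" "\<forall>\<^sub>F \<epsilon> in at_right 0. emeasure lborel {z\<in>V. \<bar>S z\<bar> < \<epsilon>} \<le> ennreal (B * h \<epsilon>)"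
    and h: "\<forall>\<^sub>F \<epsilon> in at_right 0. h \<epsilon> > 0"
    and \<phi>: "continuous_on UNIV \<phi>" "compact (supp \<phi>)" "supp \<phi> \<subseteq> V"
  shows "\<exists>B>0. \<forall>\<^sub>F \<epsilon> in at_right 0. sublevel_integral U S \<phi> \<epsilon> < B * h \<epsilon>"
proof -
  have "compact (\<phi> ` supp \<phi>)"
    by (rule compact_continuous_image[OF continuous_on_subset[OF \<phi>(1)] \<phi>(2)]) auto
  then obtain M where M: "M > 0" "\<And>z. z \<in> supp \<phi> \<Longrightarrow> \<bar>\<phi> z\<bar> \<le> M"
    using compact_imp_bounded bounded_pos by (metis (no_types, lifting) imageI real_norm_def)
  have outside: "\<phi> z = 0" if "z \<notin> supp \<phi>" for z
    using that closure_subset[of "{p. \<phi> p \<noteq> 0}"] unfolding supp_def by blast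
  \<comment> \<open>The summand 1 makes the inequality strict, as h is positive.\<close>
  have "\<forall>\<^sub>F \<epsilon> in at_right 0. sublevel_integral U S \<phi> \<epsilon> < (M * B + 1) * h \<epsilon>"
    using B(2) h
  proof eventually_elim
    case (elim \<epsilon>)
    let ?E = "{z\<in>V. \<bar>S z\<bar> < \<epsilon>}"
    have Em: "?E \<in> sets lborel"
    proof -
      have "open (V \<inter> S -` {-\<epsilon><..<\<epsilon>})"
        using continuous_on_open_vimage[OF V(1)] continuous_on_subset[OF S V(2)]
        by (metis Int_commute open_greaterThanLessThan)
      moreover have "V \<inter> S -` {-\<epsilon><..<\<epsilon>} = ?E" by auto
      ultimately show ?thesis by simp
    qed
    have fin: "emeasure lborel ?E < \<infinity>" using elim(1) by (rule le_less_trans) simp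
    have meas: "measure lborel ?E \<le> B * h \<epsilon>"
      using elim B(1) by (simp add: measure_def enn2real_leI)
    have "sublevel_integral U S \<phi> \<epsilon> = (\<integral>p. indicator {p\<in>U. 0 < S p \<and> S p < \<epsilon>} p * \<phi> p \<partial>lborel)"
      by (simp add: sublevel_integral_def set_lebesgue_integral_def)
    also have "\<dots> \<le> (\<integral>p. M * indicator ?E p \<partial>lborel)"
    \<comment> \<open>Integrability is asked of the majorant; an integrand that is not integrable
      would have integral 0 by convention, which the nonnegative majorant covers as well.\<close>
    proof (rule integral_mono')
      show "integrable lborel (\<lambda>p. M * indicator ?E p :: real)"
        using Em fin by (intro integrable_mult_right integrable_real_indicator) auto
      fix p
      show "indicator {p\<in>U. 0 < S p \<and> S p < \<epsilon>} p * \<phi> p \<le> M * indicator ?E p"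
      proof (cases "p \<in> supp \<phi>")
        case True
        then have "p \<in> V" "\<phi> p \<le> M" using \<phi>(3) True abs_le_D1[OF M(2)[OF True]] by auto
        then show ?thesis using M(1) by (auto simp: indicator_def)
      qed (use outside M(1) in auto)
      show "0 \<le> M * indicator ?E p" using M(1) by simp
    qed
    also have "\<dots> = M * measure lborel ?E" using Em by simp
    also have "\<dots> \<le> M * (B * h \<epsilon>)" using meas M(1) by (intro mult_left_mono) auto
    also have "\<dots> < (M * B + 1) * h \<epsilon>" using elim(2) by (simp add: algebra_simps)
    finally show ?case .
  qed
  then show ?thesis using M(1) B(1) by (intro exI[of _ "M * B + 1"]) (auto intro: add_pos_pos)
qed

theorem theorem1:
  fixes S :: "real \<times> real \<Rightarrow> real" and U :: "(real \<times> real) set"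
  assumes "open U" and "(0, 0) \<in> U" and "smooth_on S U"
    and "S (0, 0) = 0" and "GDERIV S (0, 0) :> (0, 0)"
    and "\<exists>a b. taylor_coeff S a b \<noteq> 0"
    and "superadapted S"
    and "newton_distance S > 1"
  shows "\<exists>V. open V \<and> (0, 0) \<in> V \<and> V \<subseteq> U \<and>
    (\<forall>\<phi> :: real \<times> real \<Rightarrow> real.
       smooth_on \<phi> UNIV \<and> compact (supp \<phi>) \<and> supp \<phi> \<subseteq> V \<longrightarrow>
       (case1 S \<or> case3 S \<longrightarrow>
          (\<exists>B>0. \<forall>\<^sub>F \<epsilon> in at_right 0.
             sublevel_integral U S \<phi> \<epsilon> < B * \<epsilon> powr (1 / newton_distance S))) \<and>
       (case2 S \<longrightarrow>
          (\<exists>B>0. \<forall>\<^sub>F \<epsilon> in at_right 0.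
             sublevel_integral U S \<phi> \<epsilon> < B * \<bar>ln \<epsilon>\<bar> * \<epsilon> powr (1 / newton_distance S))))"
proof -
  let ?d = "newton_distance S"
  have d: "?d = newton_distance S" "?d > 0" using assms(8) by auto
  obtain a0 b0 where nz: "taylor_coeff S a0 b0 \<noteq> 0" using assms(6) by blast
  have S0: "S (0, 0) = 0" by (rule assms(4))
  have pq: "p + q > 0" "w > 0" "K \<ge> 1" if "admissible_weights S p q w K" for p q w K
    using that unfolding admissible_weights_def by auto
  have A: "case1 S \<or> case3 S \<longrightarrow> sublevel_bounded_by S U (\<lambda>\<epsilon>. \<epsilon> powr (1 / ?d))"
  proof (intro impI, elim disjE)
    assume "case1 S"
    then obtain p q K where K: "real K < ?d" and aw: "admissible_weights S p q (?d * (p + q)) K"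
      using case1_weights[OF _ assms(7) S0 d(1) assms(8) nz] by blast
    show "sublevel_bounded_by S U (\<lambda>\<epsilon>. \<epsilon> powr (1 / ?d))"
      by (rule sublevel_bounded_byI[OF assms(3,1,2) aw zero_less_one])
        (rule scale_sum_gt[OF pq(2)[OF aw] pq(1)[OF aw] d(2) _ K pq(3)[OF aw] refl])
  next
    assume "case3 S"
    then obtain p q w K where K: "real K = ?d" "w < ?d * (p + q)" and aw: "admissible_weights S p q w K"
      using case3_weights[OF _ S0 d(1) assms(8) nz] by blast
    show "sublevel_bounded_by S U (\<lambda>\<epsilon>. \<epsilon> powr (1 / ?d))"
      by (rule sublevel_bounded_byI[OF assms(3,1,2) aw zero_less_one])
        (rule scale_sum_lt[OF pq(2)[OF aw] pq(1)[OF aw] d(2) _ K])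
  qed
  have B: "case2 S \<longrightarrow> sublevel_bounded_by S U (\<lambda>\<epsilon>. \<bar>ln \<epsilon>\<bar> * \<epsilon> powr (1 / ?d))"
  proof
    assume "case2 S"
    then obtain p q K where K: "real K = ?d" and aw: "admissible_weights S p q (?d * (p + q)) K"
      using case2_weights[OF _ assms(7) S0 d(1) assms(8) nz] by blast
    show "sublevel_bounded_by S U (\<lambda>\<epsilon>. \<bar>ln \<epsilon>\<bar> * \<epsilon> powr (1 / ?d))"
      by (rule sublevel_bounded_byI[OF assms(3,1,2) aw, of "exp (-1)"])
        (use scale_sum_eq[OF pq(2)[OF aw] pq(1)[OF aw] d(2) _ K refl] in \<open>simp_all add: mult.assoc\<close>)
  qed
  \<comment> \<open>V is asserted outside the implication, so it is available also when P fails
    (then U itself is taken). The neighborhoods for the two assertions can therefore be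
    intersected.\<close>
  have nhd: "\<exists>V. open V \<and> (0, 0) \<in> V \<and> V \<subseteq> U \<and> (P \<longrightarrow> (\<forall>\<phi>.
      smooth_on \<phi> UNIV \<and> compact (supp \<phi>) \<and> supp \<phi> \<subseteq> V \<longrightarrow>
      (\<exists>B>0. \<forall>\<^sub>F \<epsilon> in at_right 0. sublevel_integral U S \<phi> \<epsilon> < B * h \<epsilon>)))"
    if bd: "P \<longrightarrow> sublevel_bounded_by S U h" and h: "\<forall>\<^sub>F \<epsilon> in at_right 0. h \<epsilon> > 0" for P h
  proof (cases P)
    case True
    then obtain V B where V: "open V" "(0, 0) \<in> V" "V \<subseteq> U"
      and B: "B > 0" "\<forall>\<^sub>F \<epsilon> in at_right 0. emeasure lborel {z\<in>V. \<bar>S z\<bar> < \<epsilon>} \<le> ennreal (B * h \<epsilon>)"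
      using bd unfolding sublevel_bounded_by_def by blast
    have "\<exists>B>0. \<forall>\<^sub>F \<epsilon> in at_right 0. sublevel_integral U S \<phi> \<epsilon> < B * h \<epsilon>"
      if "smooth_on \<phi> UNIV" "compact (supp \<phi>)" "supp \<phi> \<subseteq> V" for \<phi>
      by (rule sublevel_integral_less[OF smooth_on_imp_continuous_on[OF assms(3)] assms(1) V(1,3) B h
            smooth_on_imp_continuous_on[OF that(1)] that(2,3)])
    then show ?thesis using V by blast
  qed (use assms(1,2) in auto)
  have pos: "\<forall>\<^sub>F \<epsilon> in at_right (0::real). 0 < \<epsilon> \<and> \<epsilon> < 1"
    by (intro eventually_conj eventually_at_right_less order_tendstoD(2)[of "\<lambda>x. x" 0])
      (auto intro: tendsto_ident_at)
  have h1: "\<forall>\<^sub>F \<epsilon> in at_right 0. \<epsilon> powr (1 / ?d) > 0"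
    using pos by eventually_elim simp
  have h2: "\<forall>\<^sub>F \<epsilon> in at_right 0. \<bar>ln \<epsilon>\<bar> * \<epsilon> powr (1 / ?d) > 0"
    using pos by eventually_elim (intro mult_pos_pos, auto)
  obtain V1 where V1: "open V1" "(0, 0) \<in> V1" "V1 \<subseteq> U"
    "case1 S \<or> case3 S \<longrightarrow> (\<forall>\<phi>. smooth_on \<phi> UNIV \<and> compact (supp \<phi>) \<and> supp \<phi> \<subseteq> V1 \<longrightarrow>
      (\<exists>B>0. \<forall>\<^sub>F \<epsilon> in at_right 0. sublevel_integral U S \<phi> \<epsilon> < B * \<epsilon> powr (1 / ?d)))"
    using nhd[OF A h1] by (elim exE conjE) (rule that)
  obtain V2 where V2: "open V2" "(0, 0) \<in> V2" "V2 \<subseteq> U"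
    "case2 S \<longrightarrow> (\<forall>\<phi>. smooth_on \<phi> UNIV \<and> compact (supp \<phi>) \<and> supp \<phi> \<subseteq> V2 \<longrightarrow>
      (\<exists>B>0. \<forall>\<^sub>F \<epsilon> in at_right 0. sublevel_integral U S \<phi> \<epsilon> < B * (\<bar>ln \<epsilon>\<bar> * \<epsilon> powr (1 / ?d))))"
    using nhd[OF B h2] by (elim exE conjE) (rule that)
  show ?thesis
  proof (intro exI[of _ "V1 \<inter> V2"] conjI allI impI; (elim conjE)?)
    fix \<phi> :: "real \<times> real \<Rightarrow> real"
    assume \<phi>: "smooth_on \<phi> UNIV" "compact (supp \<phi>)" "supp \<phi> \<subseteq> V1 \<inter> V2"
    show "\<exists>B>0. \<forall>\<^sub>F \<epsilon> in at_right 0. sublevel_integral U S \<phi> \<epsilon> < B * \<epsilon> powr (1 / ?d)"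
      if "case1 S \<or> case3 S"
      using V1(4)[THEN mp, OF that, THEN spec, of \<phi>] \<phi> by simp
    show "\<exists>B>0. \<forall>\<^sub>F \<epsilon> in at_right 0. sublevel_integral U S \<phi> \<epsilon> < B * \<bar>ln \<epsilon>\<bar> * \<epsilon> powr (1 / ?d)"
      if "case2 S"
      using V2(4)[THEN mp, OF that, THEN spec, of \<phi>] \<phi> by (simp add: mult.assoc)
  qed (use V1 V2 in auto)
qed

end
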